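(* Let $P$ be a unital subsemigroup of a discrete group $G$ and let $X$ be a product system over $P$. Then $$\lambda(A)\bigcap c_0(\mathcal{L}(X_F)\mid \text{finite } F\subseteq G)=(0),$$ where $\lambda(A)\subseteq[\mathcal{T}_\lambda(X)]_e$ is regarded in $\prod_{\text{finite }F\subseteq G}\mathcal{L}(X_F)$ via the $*$-representation $b\mapsto (b|_{X_F})_F$.
   Context: **Product systems.** $P$ is a unital discrete left-cancellative semigroup with unit $e$. A product system $X$ over $P$ is a family $\{X_p\}_{p\in P}$ of closed subspaces of some $\mathcal{B}(H)$ such that $A := X_e$ is a C*-algebra, $X_p\cdot X_q\subseteq X_{pq}$ and $X_p^*\cdot X_{pq}\subseteq X_q$ for all $p,q\in P$. Each $X_p$ is a C*-correspondence over $A$ with operations from $\mathcal{B}(H)$ and $\langle \xi,\eta\rangle=\xi^*\eta$; the left action is denoted $\varphi_p\colon A\to\mathcal{L}(X_p)$. **Fock representation.** $\mathcal{F}X=\bigoplus_{r\in P}X_r$ (right Hilbert $A$-module), and for $\xi_p\in X_p$ the adjointable operator $\lambda(\xi_p)$ on $\mathcal{F}X$ is given by $\lambda(\xi_p)\eta_r=\xi_p\eta_r$, $\eta_r\in X_r$. $\mathcal{T}_\lambda(X)$ is the C*-algebra generated by all $\lambda(\xi_p)$. It has a coaction of $G$ with $\lambda(\xi_p)\mapsto\lambda(\xi_p)\otimes u_p\in\mathcal{T}_\lambda(X)\otimes\mathrm{C}^*_{\max}(G)$ ($u_g$ the canonical generators of $\mathrm{C}^*_{\max}(G)$), and $[\mathcal{T}_\lambda(X)]_e$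 is the set of elements $b$ mapped to $b\otimes u_e$. **The modules $X_F$.** For finite $F\subseteq G$ let $K_F=\bigcap_{g\in F}gP$. For $r\in P$, $g\in G$ let $I_{r^{-1}K_{\{r,g\}}}=\bigcap_{s\in K_{\{r,g\}}}\ker\varphi_{r^{-1}s}$ if $K_{\{r,g\}}\neq\emptyset$ and $r\notin K_{\{r,g\}}$, and $I_{r^{-1}K_{\{r,g\}}}=A$ otherwise. Let $I_{r^{-1}(r\vee F)}=\bigcap_{g\in F}I_{r^{-1}K_{\{r,g\}}}$ ($=A$ if $F=\emptyset$) and $X_F=\bigoplus_{r\in P}X_rI_{r^{-1}(r\vee F)}\subseteq\mathcal{F}X$. Each $X_F$ is invariant under $[\mathcal{T}_\lambda(X)]_e$. $c_0(\mathcal{L}(X_F)\mid\text{finite }F\subseteq G)$ is the set of bounded families $(T_F)_F$ with $\lim_F\|T_F\|=0$ along the finite subsets of $G$ directed by inclusion, i.e. for every $\varepsilon>0$ there is a finite $F_0\subseteq G$ with $\|T_F\|<\varepsilon$ for all finite $F\supseteq F_0$. *)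

theory Defs
  imports "HOL-Analysis.Analysis" "HOL-Algebra.Coset"
begin

section \<open>Complex Hilbert spaces and the operators on them\<close>

text \<open>The real Hilbert space structure (norm, topology, completeness) comes from the library; the
  class adds the complex structure. The inner product is linear in the second variable.\<close>

class chilbert_space = real_inner + complete_space +
  fixes scaleC :: "complex \<Rightarrow> 'a \<Rightarrow> 'a" (infixr \<open>*\<^sub>C\<close> 75)
    and cinner :: "'a \<Rightarrow> 'a \<Rightarrow> complex"
  assumes scaleC_add_right: "c *\<^sub>C (x + y) = c *\<^sub>C x + c *\<^sub>C y"
    and scaleC_add_left: "(c + d) *\<^sub>C x = c *\<^sub>C x + d *\<^sub>C x"
    and scaleC_scaleC: "c *\<^sub>C d *\<^sub>C x = (c * d) *\<^sub>C x"
    and scaleC_of_real: "complex_of_real r *\<^sub>C x = scaleR r x"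
    and cinner_commute: "cinner x y = cnj (cinner y x)"
    and cinner_add_right: "cinner x (y + z) = cinner x y + cinner x z"
    and cinner_scaleC_right: "cinner x (c *\<^sub>C y) = c * cinner x y"
    and inner_eq_Re_cinner: "inner x y = Re (cinner x y)"

text \<open>\<open>B(H)\<close> is the set of complex-linear elements of the real Banach space of bounded real-linear
  operators, with the operator norm and its topology inherited from there.\<close>

definition BH :: "('h::chilbert_space \<Rightarrow>\<^sub>L 'h) set" where
  "BH = {T. \<forall>c x. blinfun_apply T (c *\<^sub>C x) = c *\<^sub>C blinfun_apply T x}"

definition scale_op :: "complex \<Rightarrow> ('h::chilbert_space \<Rightarrow>\<^sub>L 'h) \<Rightarrow> 'h \<Rightarrow>\<^sub>L 'h" where
  "scale_op c T = Blinfun (\<lambda>x. c *\<^sub>C blinfun_apply T x)"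

text \<open>The Hilbert space adjoint; for \<open>T\<close> in \<open>B(H)\<close> it exists by the Riesz representation
  theorem and is unique.\<close>

definition adj_op :: "('h::chilbert_space \<Rightarrow>\<^sub>L 'h) \<Rightarrow> 'h \<Rightarrow>\<^sub>L 'h" where
  "adj_op T = (THE S. \<forall>x y. cinner (blinfun_apply S x) y = cinner x (blinfun_apply T y))"

definition closed_csubspace :: "('h::chilbert_space \<Rightarrow>\<^sub>L 'h) set \<Rightarrow> bool" where
  "closed_csubspace V \<longleftrightarrow> V \<subseteq> BH \<and> closed V \<and> 0 \<in> V
     \<and> (\<forall>S\<in>V. \<forall>T\<in>V. S + T \<in> V) \<and> (\<forall>c. \<forall>T\<in>V. scale_op c T \<in> V)"

definition cstar_subalgebra :: "('h::chilbert_space \<Rightarrow>\<^sub>L 'h) set \<Rightarrow> bool" where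
  "cstar_subalgebra A \<longleftrightarrow> closed_csubspace A
     \<and> (\<forall>a\<in>A. \<forall>b\<in>A. a o\<^sub>L b \<in> A) \<and> (\<forall>a\<in>A. adj_op a \<in> A)"


section \<open>Product systems\<close>

text \<open>\<open>P\<close> is a subsemigroup of \<open>G\<close>; the coefficient algebra \<open>A\<close> is \<open>X \<one>\<close>. As the
  \<open>X p\<close> are closed subspaces, it is enough to ask for the inclusions elementwise.\<close>

definition product_system ::
  "('g, 'm) monoid_scheme \<Rightarrow> 'g set \<Rightarrow> ('g \<Rightarrow> ('h::chilbert_space \<Rightarrow>\<^sub>L 'h) set) \<Rightarrow> bool" where
  "product_system G P X \<longleftrightarrow>
     (\<forall>p\<in>P. closed_csubspace (X p)) \<and> cstar_subalgebra (X \<one>\<^bsub>G\<^esub>) \<and>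
     (\<forall>p\<in>P. \<forall>q\<in>P. \<forall>\<xi>\<in>X p. \<forall>\<eta>\<in>X q. \<xi> o\<^sub>L \<eta> \<in> X (p \<otimes>\<^bsub>G\<^esub> q)) \<and>
     (\<forall>p\<in>P. \<forall>q\<in>P. \<forall>\<xi>\<in>X p. \<forall>\<zeta>\<in>X (p \<otimes>\<^bsub>G\<^esub> q). adj_op \<xi> o\<^sub>L \<zeta> \<in> X q)"

text \<open>The kernel of the left action of \<open>A\<close> on \<open>X p\<close>.\<close>

definition ker_phi ::
  "('g, 'm) monoid_scheme \<Rightarrow> ('g \<Rightarrow> ('h::chilbert_space \<Rightarrow>\<^sub>L 'h) set) \<Rightarrow> 'g \<Rightarrow> ('h \<Rightarrow>\<^sub>L 'h) set" where
  "ker_phi G X p = {a \<in> X \<one>\<^bsub>G\<^esub>. \<forall>\<xi>\<in>X p. a o\<^sub>L \<xi> = 0}"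


section \<open>Direct sums of Hilbert modules and adjointable operators\<close>

text \<open>All Hilbert modules below are submodules of the Fock module. Their elements are families in
  \<open>B(H)\<close> indexed by the group, vanishing off \<open>P\<close>; the inner product is
  \<open>\<langle>\<xi>,\<eta>\<rangle> = \<Sum>\<^sub>r \<xi>\<^sub>r\<^sup>* \<eta>\<^sub>r\<close>, an unordered sum converging in norm.\<close>

definition dsum ::
  "'g set \<Rightarrow> ('g \<Rightarrow> ('h::chilbert_space \<Rightarrow>\<^sub>L 'h) set) \<Rightarrow> ('g \<Rightarrow> 'h \<Rightarrow>\<^sub>L 'h) set" where
  "dsum P Y = {\<eta>. (\<forall>r\<in>P. \<eta> r \<in> Y r) \<and> (\<forall>r. r \<notin> P \<longrightarrow> \<eta> r = 0)
                  \<and> (\<lambda>r. adj_op (\<eta> r) o\<^sub>L \<eta> r) summable_on P}"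

definition mod_inner ::
  "'g set \<Rightarrow> ('g \<Rightarrow> 'h::chilbert_space \<Rightarrow>\<^sub>L 'h) \<Rightarrow> ('g \<Rightarrow> 'h \<Rightarrow>\<^sub>L 'h) \<Rightarrow> 'h \<Rightarrow>\<^sub>L 'h" where
  "mod_inner P \<xi> \<eta> = (\<Sum>\<^sub>\<infinity>r\<in>P. adj_op (\<xi> r) o\<^sub>L \<eta> r)"

definition mod_norm :: "'g set \<Rightarrow> ('g \<Rightarrow> 'h::chilbert_space \<Rightarrow>\<^sub>L 'h) \<Rightarrow> real" where
  "mod_norm P \<eta> = sqrt (norm (mod_inner P \<eta> \<eta>))"

text \<open>\<open>\<L>(E)\<close>: the adjointable maps on \<open>E\<close>, as extensional functions on the
  carrier \<open>E\<close>. They are automatically linear and bounded.\<close>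

definition adjointable ::
  "'g set \<Rightarrow> ('g \<Rightarrow> 'h::chilbert_space \<Rightarrow>\<^sub>L 'h) set
     \<Rightarrow> (('g \<Rightarrow> 'h \<Rightarrow>\<^sub>L 'h) \<Rightarrow> 'g \<Rightarrow> 'h \<Rightarrow>\<^sub>L 'h) set" where
  "adjointable P E = {T \<in> E \<rightarrow>\<^sub>E E. \<exists>S \<in> E \<rightarrow>\<^sub>E E. \<forall>\<xi>\<in>E. \<forall>\<eta>\<in>E.
                         mod_inner P (T \<xi>) \<eta> = mod_inner P \<xi> (S \<eta>)}"

definition mod_opnorm ::
  "'g set \<Rightarrow> ('g \<Rightarrow> 'h::chilbert_space \<Rightarrow>\<^sub>L 'h) set
     \<Rightarrow> (('g \<Rightarrow> 'h \<Rightarrow>\<^sub>L 'h) \<Rightarrow> 'g \<Rightarrow> 'h \<Rightarrow>\<^sub>L 'h) \<Rightarrow> real" where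
  "mod_opnorm P E T = (SUP \<eta>\<in>{\<eta>\<in>E. mod_norm P \<eta> \<le> 1}. mod_norm P (T \<eta>))"


section \<open>The Fock representation\<close>

definition fock :: "'g set \<Rightarrow> ('g \<Rightarrow> ('h::chilbert_space \<Rightarrow>\<^sub>L 'h) set) \<Rightarrow> ('g \<Rightarrow> 'h \<Rightarrow>\<^sub>L 'h) set" where
  "fock P X = dsum P X"

text \<open>\<open>fock_rep G P X p \<xi>\<close> is \<open>\<lambda>(\<xi>)\<close> for \<open>\<xi>\<close> in \<open>X p\<close>. It maps the summand
  \<open>X r\<close> to \<open>X (pr)\<close>, hence its \<open>s\<close>-th component lives on \<open>s \<in> pP\<close> and depends on the
  component of the argument at \<open>p\<^sup>-\<^sup>1s\<close>.\<close>

definition fock_rep ::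
  "('g, 'm) monoid_scheme \<Rightarrow> 'g set \<Rightarrow> ('g \<Rightarrow> ('h::chilbert_space \<Rightarrow>\<^sub>L 'h) set)
     \<Rightarrow> 'g \<Rightarrow> ('h \<Rightarrow>\<^sub>L 'h) \<Rightarrow> ('g \<Rightarrow> 'h \<Rightarrow>\<^sub>L 'h) \<Rightarrow> 'g \<Rightarrow> 'h \<Rightarrow>\<^sub>L 'h" where
  "fock_rep G P X p \<xi> = (\<lambda>\<eta>\<in>fock P X. \<lambda>s.
     if s \<in> p <#\<^bsub>G\<^esub> P then \<xi> o\<^sub>L \<eta> (inv\<^bsub>G\<^esub> p \<otimes>\<^bsub>G\<^esub> s) else 0)"

definition lambda_A ::
  "('g, 'm) monoid_scheme \<Rightarrow> 'g set \<Rightarrow> ('g \<Rightarrow> ('h::chilbert_space \<Rightarrow>\<^sub>L 'h) set)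
     \<Rightarrow> (('g \<Rightarrow> 'h \<Rightarrow>\<^sub>L 'h) \<Rightarrow> 'g \<Rightarrow> 'h \<Rightarrow>\<^sub>L 'h) set" where
  "lambda_A G P X = fock_rep G P X \<one>\<^bsub>G\<^esub> ` X \<one>\<^bsub>G\<^esub>"


section \<open>The modules \<open>X\<^sub>F\<close>\<close>

definition KF :: "('g, 'm) monoid_scheme \<Rightarrow> 'g set \<Rightarrow> 'g set \<Rightarrow> 'g set" where
  "KF G P F = carrier G \<inter> (\<Inter>g\<in>F. g <#\<^bsub>G\<^esub> P)"

text \<open>The ideal \<open>I\<close> with index \<open>r\<^sup>-\<^sup>1K\<^sub>{\<^sub>r\<^sub>,\<^sub>g\<^sub>}\<close>.\<close>

definition ideal_rg ::
  "('g, 'm) monoid_scheme \<Rightarrow> 'g set \<Rightarrow> ('g \<Rightarrow> ('h::chilbert_space \<Rightarrow>\<^sub>L 'h) set)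
     \<Rightarrow> 'g \<Rightarrow> 'g \<Rightarrow> ('h \<Rightarrow>\<^sub>L 'h) set" where
  "ideal_rg G P X r g =
     (if KF G P {r, g} \<noteq> {} \<and> r \<notin> KF G P {r, g}
      then (\<Inter>s\<in>KF G P {r, g}. ker_phi G X (inv\<^bsub>G\<^esub> r \<otimes>\<^bsub>G\<^esub> s))
      else X \<one>\<^bsub>G\<^esub>)"

text \<open>The ideal \<open>I\<close> with index \<open>r\<^sup>-\<^sup>1(r \<or> F)\<close>.\<close>

definition ideal_rF ::
  "('g, 'm) monoid_scheme \<Rightarrow> 'g set \<Rightarrow> ('g \<Rightarrow> ('h::chilbert_space \<Rightarrow>\<^sub>L 'h) set)
     \<Rightarrow> 'g \<Rightarrow> 'g set \<Rightarrow> ('h \<Rightarrow>\<^sub>L 'h) set" where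
  "ideal_rF G P X r F = X \<one>\<^bsub>G\<^esub> \<inter> (\<Inter>g\<in>F. ideal_rg G P X r g)"

text \<open>The product of two subspaces is the closed linear span of the elementwise products.\<close>

definition op_prod ::
  "('h::chilbert_space \<Rightarrow>\<^sub>L 'h) set \<Rightarrow> ('h \<Rightarrow>\<^sub>L 'h) set \<Rightarrow> ('h \<Rightarrow>\<^sub>L 'h) set" where
  "op_prod Y Z = closed_csubspace hull {\<xi> o\<^sub>L a | \<xi> a. \<xi> \<in> Y \<and> a \<in> Z}"

definition XF ::
  "('g, 'm) monoid_scheme \<Rightarrow> 'g set \<Rightarrow> ('g \<Rightarrow> ('h::chilbert_space \<Rightarrow>\<^sub>L 'h) set)
     \<Rightarrow> 'g set \<Rightarrow> ('g \<Rightarrow> 'h \<Rightarrow>\<^sub>L 'h) set" where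
  "XF G P X F = dsum P (\<lambda>r. op_prod (X r) (ideal_rF G P X r F))"

abbreviation finite_subsets :: "('g, 'm) monoid_scheme \<Rightarrow> 'g set set" where
  "finite_subsets G \<equiv> {F. finite F \<and> F \<subseteq> carrier G}"

text \<open>The map \<open>b \<mapsto> (b|X\<^sub>F)\<^sub>F\<close>.\<close>

definition restrictions ::
  "('g, 'm) monoid_scheme \<Rightarrow> 'g set \<Rightarrow> ('g \<Rightarrow> ('h::chilbert_space \<Rightarrow>\<^sub>L 'h) set)
     \<Rightarrow> (('g \<Rightarrow> 'h \<Rightarrow>\<^sub>L 'h) \<Rightarrow> 'g \<Rightarrow> 'h \<Rightarrow>\<^sub>L 'h)
     \<Rightarrow> 'g set \<Rightarrow> ('g \<Rightarrow> 'h \<Rightarrow>\<^sub>L 'h) \<Rightarrow> 'g \<Rightarrow> 'h \<Rightarrow>\<^sub>L 'h" where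
  "restrictions G P X b = (\<lambda>F\<in>finite_subsets G. restrict b (XF G P X F))"

definition c0_XF ::
  "('g, 'm) monoid_scheme \<Rightarrow> 'g set \<Rightarrow> ('g \<Rightarrow> ('h::chilbert_space \<Rightarrow>\<^sub>L 'h) set)
     \<Rightarrow> ('g set \<Rightarrow> ('g \<Rightarrow> 'h \<Rightarrow>\<^sub>L 'h) \<Rightarrow> 'g \<Rightarrow> 'h \<Rightarrow>\<^sub>L 'h) set" where
  "c0_XF G P X = {T \<in> (\<Pi>\<^sub>E F\<in>finite_subsets G. adjointable P (XF G P X F)).
     (\<exists>C. \<forall>F\<in>finite_subsets G. mod_opnorm P (XF G P X F) (T F) \<le> C) \<and>
     ((\<lambda>F. mod_opnorm P (XF G P X F) (T F)) \<longlongrightarrow> 0) (finite_subsets_at_top (carrier G))}"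

definition zero_family ::
  "('g, 'm) monoid_scheme \<Rightarrow> 'g set \<Rightarrow> ('g \<Rightarrow> ('h::chilbert_space \<Rightarrow>\<^sub>L 'h) set)
     \<Rightarrow> 'g set \<Rightarrow> ('g \<Rightarrow> 'h \<Rightarrow>\<^sub>L 'h) \<Rightarrow> 'g \<Rightarrow> 'h \<Rightarrow>\<^sub>L 'h" where
  "zero_family G P X = (\<lambda>F\<in>finite_subsets G. \<lambda>\<eta>\<in>XF G P X F. \<lambda>r. 0)"

end

theory Submission
  imports Defs
begin

text \<open>Let \<open>a \<in> A\<close> and suppose that the norms of \<open>\<lambda>(a)\<close> on the modules \<open>X\<^sub>F\<close> tend to \<open>0\<close>. A
  *-homomorphism between C*-algebras that is injective is isometric, so it is enough that \<open>A\<close> acts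
  faithfully on every single \<open>X\<^sub>F\<close>: the norms are then all equal to \<open>\<parallel>a\<parallel>\<close>, and \<open>a = 0\<close>.

  Faithfulness (lemma \<open>A_faithful_on_XF\<close>) is a maximality argument. Suppose \<open>f \<noteq> 0\<close> and \<open>F\<close> is finite.
  Then \<open>f\<close> does not kill \<open>X\<^sub>e\<close>. Among all \<open>r \<in> P\<close> with \<open>f X\<^sub>r \<noteq> 0\<close> take one that lies in as many of
  the sets \<open>gP\<close>, \<open>g \<in> F\<close>, as possible. If \<open>r \<notin> gP\<close>, every \<open>s \<in> rP \<inter> gP\<close> lies in strictly more of them,
  so \<open>f\<close> kills \<open>X\<^sub>s\<close>, hence \<open>f X\<^sub>r\<close> kills \<open>X\<close> at \<open>r\<^sup>-\<^sup>1s\<close>. For \<open>\<theta> \<in> f X\<^sub>r\<close> this puts \<open>\<theta>\<^sup>*\<theta>\<close> into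
  the ideal that defines the \<open>r\<close>-th summand of \<open>X\<^sub>F\<close>, and \<open>\<theta>\<theta>\<^sup>*\<theta> \<noteq> 0\<close> unless \<open>\<theta> = 0\<close>. So \<open>f\<close> does not
  kill \<open>X\<^sub>F\<close>.

  To pass from faithfulness to norms one cuts off the spectrum. With \<open>b = a\<^sup>*a\<close> and \<open>T = b - c\<close>, the
  operator \<open>f = (\<bar>T\<bar> + T) b\<close> belongs to \<open>A\<close>, and it kills \<open>X\<^sub>F\<close> as soon as \<open>b\<close> acts on \<open>X\<^sub>F\<close> with norm
  at most \<open>c\<close>. Then \<open>f = 0\<close>, which says that \<open>b \<le> c\<close> on the range of \<open>b\<close>. As this can be had
  for each \<open>c > 0\<close>, it follows that \<open>a = 0\<close>. The only function of a self-adjoint operator needed is its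
  absolute value, which an explicit iteration with polynomials produces; since \<open>A\<close> and the
  \<open>X\<^sub>r\<close> are norm closed, multiplication by it leaves them invariant.\<close>


section \<open>Self-adjoint operators on real Hilbert spaces\<close>

instance chilbert_space \<subseteq> banach ..

lemma blinfun_compose_assoc: "(A o\<^sub>L B) o\<^sub>L C = A o\<^sub>L (B o\<^sub>L C)"
  by (rule blinfun_eqI) simp

lemma blinfun_compose_id: "T o\<^sub>L id_blinfun = T" "id_blinfun o\<^sub>L T = T"
  by (rule blinfun_eqI, simp)+

text \<open>For small \<open>t\<close> of the sign opposite to \<open>\<alpha>\<close> the linear term dominates. This is how first-order
  conditions are extracted below from minimality and from positivity of a form.\<close>

lemma quadratic_nonneg_imp_linear_coeff_zero:
  fixes \<alpha> \<beta> :: real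
  assumes "\<And>t. 0 \<le> 2 * t * \<alpha> + t\<^sup>2 * \<beta>"
  shows "\<alpha> = 0"
proof (rule ccontr)
  assume "\<alpha> \<noteq> 0"
  define B where "B = \<bar>\<beta>\<bar> + 1"
  have B: "0 < B" "\<beta> < B" by (auto simp: B_def)
  have "0 \<le> 2 * (- \<alpha> / B) * \<alpha> + (- \<alpha> / B)\<^sup>2 * \<beta>"
    by (rule assms)
  also have "\<dots> = (\<alpha>\<^sup>2 / B\<^sup>2) * (\<beta> - 2 * B)"
    using B by (simp add: divide_simps power2_eq_square) (simp add: algebra_simps)
  also have "\<dots> < 0"
    using B \<open>\<alpha> \<noteq> 0\<close> by (intro mult_pos_neg) auto
  finally show False by simp
qed

text \<open>The representing vector is the minimizer of \<open>\<parallel>x\<parallel>\<^sup>2 - 2 f x\<close>, whose derivative vanishes exactly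
  there; minimizing sequences are Cauchy by the parallelogram law.\<close>

lemma riesz_representation:
  fixes f :: "'a::{real_inner,complete_space} \<Rightarrow> real"
  assumes "bounded_linear f"
  obtains z where "\<And>y. f y = inner z y"
proof -
  interpret f: bounded_linear f by fact
  obtain K where K: "\<And>x. norm (f x) \<le> norm x * K" using f.bounded by blast
  define \<phi> where "\<phi> x = (norm x)\<^sup>2 - 2 * f x" for x
  have "- K\<^sup>2 \<le> \<phi> x" for x
  proof -
    have "0 \<le> (norm x - K)\<^sup>2" by simp
    then have "- K\<^sup>2 \<le> (norm x)\<^sup>2 - 2 * (norm x * K)"
      by (simp add: power2_eq_square algebra_simps)
    moreover have "f x \<le> norm x * K" using K[of x] by simp
    ultimately show ?thesis unfolding \<phi>_def by linarith
  qed
  then have bdd: "bdd_below (range \<phi>)" by (auto intro!: bdd_belowI)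
  define m where "m = Inf (range \<phi>)"
  have m: "m \<le> \<phi> x" for x unfolding m_def by (rule cInf_lower[OF _ bdd]) simp
  have "\<exists>x. \<phi> x < m + inverse (real (Suc n))" for n
    using cInf_lessD[of "range \<phi>" "m + inverse (real (Suc n))"] unfolding m_def by auto
  then obtain x where x: "\<And>n. \<phi> (x n) < m + inverse (real (Suc n))" by metis
  have dist: "(norm (u - v))\<^sup>2 \<le> 2 * (\<phi> u - m) + 2 * (\<phi> v - m)" for u v
  proof -
    have "(norm (u - v))\<^sup>2 = 2 * \<phi> u + 2 * \<phi> v - 4 * \<phi> ((1/2) *\<^sub>R (u + v))"
      unfolding \<phi>_def power2_norm_eq_inner
      by (simp add: f.scaleR f.add inner_simps inner_commute field_simps)
    then show ?thesis using m[of "(1/2) *\<^sub>R (u + v)"] by simp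
  qed
  have "Cauchy x"
  proof (rule metric_CauchyI)
    fix e :: real assume "0 < e"
    then obtain N where N: "inverse (real (Suc N)) < e\<^sup>2 / 4"
      using reals_Archimedean[of "e\<^sup>2 / 4"] by auto
    have small: "\<phi> (x n) - m < e\<^sup>2 / 4" if "N \<le> n" for n
    proof -
      have "inverse (real (Suc n)) \<le> inverse (real (Suc N))"
        using that by (intro le_imp_inverse_le) auto
      then show ?thesis using x[of n] N by linarith
    qed
    show "\<exists>N. \<forall>n\<ge>N. \<forall>k\<ge>N. dist (x n) (x k) < e"
    proof (intro exI allI impI)
      fix n k assume "N \<le> n" "N \<le> k"
      then have "(norm (x n - x k))\<^sup>2 < e\<^sup>2"
        using dist[of "x n" "x k"] small[of n] small[of k] by argo
      then show "dist (x n) (x k) < e"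
        unfolding dist_norm using \<open>0 < e\<close> by (simp add: power2_less_imp_less)
    qed
  qed
  then obtain z where z: "x \<longlonglongrightarrow> z" using Cauchy_convergent convergent_def by blast
  have "(\<lambda>n. \<phi> (x n)) \<longlonglongrightarrow> \<phi> z"
    unfolding \<phi>_def by (intro tendsto_intros z f.tendsto)
  moreover have "(\<lambda>n. m + inverse (real (Suc n))) \<longlonglongrightarrow> m + 0"
    by (intro tendsto_intros LIMSEQ_inverse_real_of_nat)
  ultimately have "\<phi> z \<le> m + 0"
    by (rule LIMSEQ_le) (use x less_imp_le in blast)
  then have min: "\<phi> z \<le> \<phi> u" for u using m[of u] by simp
  have "inner z y - f y = 0" for y
  proof (rule quadratic_nonneg_imp_linear_coeff_zero)
    fix t :: real
    have "0 \<le> \<phi> (z + t *\<^sub>R y) - \<phi> z" using min by simp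
    also have "\<dots> = 2 * t * (inner z y - f y) + t\<^sup>2 * (norm y)\<^sup>2"
      unfolding \<phi>_def power2_norm_eq_inner
      by (simp add: f.scaleR f.add inner_simps inner_commute power2_eq_square algebra_simps)
    finally show "0 \<le> 2 * t * (inner z y - f y) + t\<^sup>2 * (norm y)\<^sup>2" .
  qed
  then show ?thesis using that[of z] by simp
qed

lemma positive_form_zero_imp_apply_zero:
  fixes Q :: "'a::real_inner \<Rightarrow>\<^sub>L 'a"
  assumes sa: "\<And>x y. inner (Q x) y = inner x (Q y)"
    and pos: "\<And>x. 0 \<le> inner (Q x) x"
    and "inner (Q y) y = 0"
  shows "Q y = 0"
proof -
  have "inner (Q y) z = 0" for z
  proof (rule quadratic_nonneg_imp_linear_coeff_zero)
    fix t :: real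
    have "inner (Q z) y = inner (Q y) z" by (metis sa inner_commute)
    then have "inner (Q (y + t *\<^sub>R z)) (y + t *\<^sub>R z) = 2 * t * inner (Q y) z + t\<^sup>2 * inner (Q z) z"
      using assms(3) by (simp add: blinfun.bilinear_simps inner_simps power2_eq_square algebra_simps)
    then show "0 \<le> 2 * t * inner (Q y) z + t\<^sup>2 * inner (Q z) z"
      using pos[of "y + t *\<^sub>R z"] by simp
  qed
  then show ?thesis using inner_eq_zero_iff by blast
qed

text \<open>Here \<open>S = T\<^sup>*\<close>, and \<open>\<parallel>Tv\<parallel>\<^sup>2 = \<langle>T\<^sup>*Tv, v\<rangle>\<close>. Alternating between \<open>T\<close> and \<open>T\<^sup>*\<close> this removes factors from
  products such as \<open>TT\<^sup>*T\<close>.\<close>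

lemma apply_adjoint_apply_zero:
  fixes T S :: "'a::real_inner \<Rightarrow>\<^sub>L 'a"
  assumes "\<And>x y. inner (S x) y = inner x (T y)" and "S (T v) = 0"
  shows "T v = 0"
proof -
  have "inner (T v) (T v) = inner (S (T v)) v" by (metis assms(1) inner_commute)
  then show ?thesis using assms(2) by simp
qed

text \<open>The absolute value is \<open>Q = 1 - L\<close>, where \<open>L\<close> solves \<open>L = (D + L\<^sup>2) / 2\<close> with \<open>D = 1 - T\<^sup>2\<close>;
  then \<open>(1 - L)\<^sup>2 = 1 - D = T\<^sup>2\<close>, and \<open>\<parallel>L\<parallel> \<le> 1\<close> makes \<open>1 - L\<close> positive. The iteration
  \<open>Y \<mapsto> (D + Y\<^sup>2) / 2\<close> started at \<open>0\<close> converges in norm, because its increments are dominated by those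
  of the same iteration for the number \<open>1 \<ge> \<parallel>D\<parallel>\<close>, an increasing sequence bounded by \<open>1\<close>. The last
  clause records that \<open>Q\<close> is a norm limit of polynomials in \<open>T\<close>.\<close>

lemma abs_of_selfadjoint_contraction:
  fixes T :: "'a::{real_inner,banach} \<Rightarrow>\<^sub>L 'a"
  assumes sa: "\<And>x y. inner (T x) y = inner x (T y)" and T1: "norm T \<le> 1"
  obtains Q :: "'a \<Rightarrow>\<^sub>L 'a" where "\<And>x y. inner (Q x) y = inner x (Q y)" "\<And>x. 0 \<le> inner (Q x) x"
    "Q o\<^sub>L Q = T o\<^sub>L T" "Q o\<^sub>L T = T o\<^sub>L Q"
    "\<And>M. \<lbrakk>closed M; id_blinfun \<in> M; T \<in> M; \<And>U V. U \<in> M \<Longrightarrow> V \<in> M \<Longrightarrow> U + V \<in> M;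
        \<And>k U. U \<in> M \<Longrightarrow> k *\<^sub>R U \<in> M; \<And>U V. U \<in> M \<Longrightarrow> V \<in> M \<Longrightarrow> U o\<^sub>L V \<in> M\<rbrakk> \<Longrightarrow> Q \<in> M"
proof -
  interpret comp: bounded_bilinear "(o\<^sub>L) :: ('a \<Rightarrow>\<^sub>L 'a) \<Rightarrow> _" by (rule bounded_bilinear_blinfun_compose)
  define D where "D = id_blinfun - (T o\<^sub>L T)"
  define Y where "Y = rec_nat 0 (\<lambda>_ Z. (1/2) *\<^sub>R (D + (Z o\<^sub>L Z)))"
  have Y0: "Y 0 = 0" and YS: "Y (Suc n) = (1/2) *\<^sub>R (D + (Y n o\<^sub>L Y n))" for n
    by (simp_all add: Y_def)
  define s :: "nat \<Rightarrow> real" where "s = rec_nat 0 (\<lambda>_ z. (1 + z * z) / 2)"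
  have s0: "s 0 = 0" and sS: "s (Suc n) = (1 + s n * s n) / 2" for n
    by (simp_all add: s_def)
  have Tx: "norm (T x) \<le> norm x" for x
    using norm_blinfun[of T x] mult_right_mono[OF T1 norm_ge_zero[of x]] by linarith
  have D1: "norm D \<le> 1"
  proof (rule norm_blinfun_bound)
    fix x
    have "(norm (D x))\<^sup>2 = (norm x)\<^sup>2 - 2 * (norm (T x))\<^sup>2 + (norm (T (T x)))\<^sup>2"
      unfolding D_def
      by (simp add: blinfun.bilinear_simps power2_norm_eq_inner inner_simps inner_commute sa)
    also have "\<dots> \<le> (norm x)\<^sup>2"
      using power_mono[OF Tx[of "T x"] norm_ge_zero, of 2] zero_le_power2[of "norm (T x)"] by linarith
    finally show "norm (D x) \<le> 1 * norm x"
      using power2_le_imp_le[OF _ norm_ge_zero] by (metis mult_1)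
  qed simp
  have s_bd: "0 \<le> s n \<and> s n \<le> 1" for n
  proof (induction n)
    case (Suc n)
    then have "s n * s n \<le> 1" by (simp add: mult_le_one)
    then show ?case by (simp add: sS)
  qed (simp add: s0)
  have Yn: "norm (Y n) \<le> s n" for n
  proof (induction n)
    case (Suc n)
    have "norm (Y n o\<^sub>L Y n) \<le> s n * s n"
      using norm_blinfun_compose[of "Y n" "Y n"] mult_mono[OF Suc Suc] s_bd[of n] by fastforce
    then show ?case unfolding YS sS
      using norm_triangle_ineq[of D "Y n o\<^sub>L Y n"] D1 by simp
  qed (simp add: Y0 s0)
  have step: "norm (Y (Suc n) - Y n) \<le> s (Suc n) - s n" for n
  proof (induction n)
    case 0 then show ?case using D1 by (simp add: YS sS Y0 s0)
  next
    case (Suc n)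
    let ?d = "Y (Suc n) - Y n"
    have eq: "Y (Suc (Suc n)) - Y (Suc n) = (1/2) *\<^sub>R ((Y (Suc n) o\<^sub>L ?d) + (?d o\<^sub>L Y n))"
      by (simp add: YS[of "Suc n"] YS[of n] comp.diff_left comp.diff_right scaleR_diff_right
          scaleR_add_right comp.scaleR_left comp.scaleR_right comp.add_left comp.add_right)
    have "norm (Y (Suc n) o\<^sub>L ?d) \<le> s (Suc n) * (s (Suc n) - s n)"
      using norm_blinfun_compose[of "Y (Suc n)" ?d] mult_mono[OF Yn[of "Suc n"] Suc] s_bd[of "Suc n"]
      by fastforce
    moreover have "norm (?d o\<^sub>L Y n) \<le> (s (Suc n) - s n) * s n"
    proof -
      have "norm ?d * norm (Y n) \<le> (s (Suc n) - s n) * s n"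
        by (rule mult_mono[OF Suc Yn order_trans[OF norm_ge_zero Suc] norm_ge_zero])
      then show ?thesis using norm_blinfun_compose[of ?d "Y n"] by linarith
    qed
    ultimately have "norm (Y (Suc (Suc n)) - Y (Suc n))
        \<le> (s (Suc n) * (s (Suc n) - s n) + (s (Suc n) - s n) * s n) / 2"
      unfolding eq using norm_triangle_ineq[of "Y (Suc n) o\<^sub>L ?d" "?d o\<^sub>L Y n"] by simp
    also have "\<dots> = s (Suc (Suc n)) - s (Suc n)"
    proof -
      have "1 + s n * s n = 2 * s (Suc n)" by (simp add: sS)
      then show ?thesis unfolding sS[of "Suc n"] by (simp add: field_simps)
    qed
    finally show ?case .
  qed
  have "incseq s"
    by (rule incseq_SucI) (metis step norm_ge_zero order_trans diff_ge_0_iff_ge)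
  then have "summable (\<lambda>n. s (Suc n) - s n)"
    using incseq_convergent[of s 1] s_bd telescope_summable by metis
  then have "summable (\<lambda>n. Y (Suc n) - Y n)"
    by (rule summable_comparison_test') (use step in auto)
  then obtain L where "(\<lambda>n. \<Sum>i<n. Y (Suc i) - Y i) \<longlonglongrightarrow> L"
    using summable_LIMSEQ by blast
  then have lim: "Y \<longlonglongrightarrow> L"
    by (simp add: sum_lessThan_telescope Y0)
  have "(\<lambda>n. (1/2) *\<^sub>R (D + (Y n o\<^sub>L Y n))) \<longlonglongrightarrow> (1/2) *\<^sub>R (D + (L o\<^sub>L L))"
    by (intro tendsto_intros comp.tendsto lim)
  moreover have "(\<lambda>n. Y (Suc n)) \<longlonglongrightarrow> L" using lim by (rule LIMSEQ_Suc)
  ultimately have fixpoint: "L = (1/2) *\<^sub>R (D + (L o\<^sub>L L))"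
    unfolding YS by (rule LIMSEQ_unique[rotated])
  have app: "(\<lambda>n. Y n x) \<longlonglongrightarrow> L x" for x
    by (intro tendsto_intros lim)
  have Dsa: "inner (D x) y = inner x (D y)" for x y
    by (simp add: D_def blinfun.bilinear_simps inner_simps sa)
  have Ysa: "inner (Y n x) y = inner x (Y n y)" for n x y
    by (induction n arbitrary: x y) (simp_all add: Y0 YS blinfun.bilinear_simps inner_simps Dsa)
  have Lsa: "inner (L x) y = inner x (L y)" for x y
  proof -
    have "(\<lambda>n. inner (Y n x) y) \<longlonglongrightarrow> inner (L x) y" by (intro tendsto_intros app)
    moreover have "(\<lambda>n. inner (Y n x) y) \<longlonglongrightarrow> inner x (L y)"
      unfolding Ysa by (intro tendsto_intros app)
    ultimately show ?thesis by (rule LIMSEQ_unique)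
  qed
  have "norm L \<le> 1"
    by (rule LIMSEQ_le_const2[OF tendsto_norm[OF lim]]) (use Yn s_bd order_trans in blast)
  then have Lx: "norm (L x) \<le> norm x" for x
    using norm_blinfun[of L x] mult_right_mono[OF _ norm_ge_zero[of x], of "norm L" 1] by fastforce
  define Q where "Q = id_blinfun - L"
  have "T o\<^sub>L Y n = Y n o\<^sub>L T" for n
  proof (induction n)
    case (Suc n)
    have "T o\<^sub>L (Y n o\<^sub>L Y n) = (Y n o\<^sub>L Y n) o\<^sub>L T"
      by (metis Suc blinfun_compose_assoc)
    moreover have "T o\<^sub>L D = D o\<^sub>L T"
      by (simp add: D_def comp.diff_left comp.diff_right blinfun_compose_assoc blinfun_compose_id)
    ultimately show ?case
      by (simp add: YS comp.scaleR_left comp.scaleR_right comp.add_left comp.add_right)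
  qed (simp add: Y0)
  then have "(\<lambda>n. T o\<^sub>L Y n) \<longlonglongrightarrow> (L o\<^sub>L T)"
    by (simp add: comp.tendsto[OF lim tendsto_const])
  then have TL: "T o\<^sub>L L = L o\<^sub>L T"
    using comp.tendsto[OF tendsto_const lim] LIMSEQ_unique by blast
  show ?thesis
  proof (rule that[of Q])
    show "inner (Q x) y = inner x (Q y)" for x y
      by (simp add: Q_def blinfun.bilinear_simps inner_simps Lsa)
    show "0 \<le> inner (Q x) x" for x
    proof -
      have "inner (L x) x \<le> norm x * norm x"
        using norm_cauchy_schwarz[of "L x" x] mult_right_mono[OF Lx[of x] norm_ge_zero[of x]] by linarith
      then show ?thesis by (simp add: Q_def blinfun.bilinear_simps inner_simps flip: power2_eq_square power2_norm_eq_inner)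
    qed
    have "2 *\<^sub>R L = D + (L o\<^sub>L L)" by (subst fixpoint) simp
    then have LL: "L o\<^sub>L L = L + L - D" by (simp add: scaleR_2 algebra_simps)
    show "Q o\<^sub>L Q = T o\<^sub>L T"
      unfolding Q_def by (simp add: comp.diff_left comp.diff_right blinfun_compose_id LL) (simp add: D_def)
    show "Q o\<^sub>L T = T o\<^sub>L Q"
      by (simp add: Q_def comp.diff_left comp.diff_right blinfun_compose_id TL)
  next
    fix M :: "('a \<Rightarrow>\<^sub>L 'a) set"
    assume M: "closed M" "id_blinfun \<in> M" "T \<in> M" "\<And>U V. U \<in> M \<Longrightarrow> V \<in> M \<Longrightarrow> U + V \<in> M"
      "\<And>k U. U \<in> M \<Longrightarrow> k *\<^sub>R U \<in> M" "\<And>U V. U \<in> M \<Longrightarrow> V \<in> M \<Longrightarrow> U o\<^sub>L V \<in> M"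
    have diff: "U - V \<in> M" if "U \<in> M" "V \<in> M" for U V
      using M(4)[OF that(1) M(5)[OF that(2), of "-1"]] by simp
    have "D \<in> M" unfolding D_def by (intro diff M)
    then have "Y n \<in> M" for n
    proof (induction n)
      case 0 show ?case using M(5)[OF M(2), of 0] by (simp add: Y0)
    qed (unfold YS, intro M, auto)
    then have "L \<in> M" using M(1) lim closed_sequentially by blast
    then show "Q \<in> M" unfolding Q_def by (intro diff M)
  qed
qed

text \<open>The ratios \<open>\<parallel>b\<^sup>n\<^sup>+\<^sup>1 y\<parallel> / \<parallel>b\<^sup>n y\<parallel>\<close> increase with \<open>n\<close>, since
  \<open>\<parallel>b\<^sup>n y\<parallel>\<^sup>2 = \<langle>b\<^sup>n\<^sup>-\<^sup>1 y, b\<^sup>n\<^sup>+\<^sup>1 y\<rangle>\<close>. So if the first one exceeded \<open>c\<close>, the powers would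
  outgrow every multiple of \<open>c\<^sup>n\<close>. Below \<open>y = \<eta>h\<close> for an element \<open>\<eta>\<close> of a Hilbert module: a norm
  bound there gives the constant \<open>C = \<parallel>\<eta>\<parallel> \<parallel>h\<parallel>\<close> in place of \<open>\<parallel>y\<parallel>\<close>, which passing to powers repairs.\<close>

lemma norm_pow_selfadjoint_bound_imp_form_bound:
  fixes b :: "'a::real_inner \<Rightarrow>\<^sub>L 'a"
  assumes sa: "\<And>x y. inner (b x) y = inner x (b y)" and "0 < c"
    and bound: "\<And>n. norm ((blinfun_apply b ^^ n) y) \<le> C * c ^ n"
  shows "inner (b y) y \<le> c * (norm y)\<^sup>2"
proof (rule ccontr)
  assume neg: "\<not> ?thesis"
  define u where "u n = (blinfun_apply b ^^ n) y" for n
  have uS: "u (Suc n) = b (u n)" and u0: "u 0 = y" for n by (simp_all add: u_def)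
  have "c * (norm y)\<^sup>2 < norm (b y) * norm y"
    using neg norm_cauchy_schwarz[of "b y" y] by linarith
  then have "c * norm y * norm y < norm (b y) * norm y"
    by (simp add: power2_eq_square mult.assoc)
  then have "c * norm y < norm (b y)"
    by (rule mult_right_less_imp_less) simp
  moreover have "0 < norm y"
    using calculation by (metis blinfun.zero_right less_irrefl mult_zero_right norm_zero zero_less_norm_iff)
  ultimately obtain q where q: "q = norm (b y) / norm y" "c < q"
    by (simp add: pos_less_divide_eq)
  have "0 < q" using q \<open>0 < c\<close> by simp
  have grow: "0 < norm (u n) \<and> q * norm (u n) \<le> norm (u (Suc n))" for n
  proof (induction n)
    case 0 then show ?case using q \<open>0 < norm y\<close> by (simp add: uS u0)
  next
    case (Suc n)
    have pos: "0 < norm (u (Suc n))"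
      using Suc \<open>0 < q\<close> by (meson less_le_trans mult_pos_pos)
    have "inner (u (Suc n)) (u (Suc n)) = inner (u n) (u (Suc (Suc n)))"
      by (simp add: uS sa)
    then have "norm (u (Suc n)) * norm (u (Suc n)) \<le> norm (u n) * norm (u (Suc (Suc n)))"
      using norm_cauchy_schwarz[of "u n" "u (Suc (Suc n))"]
      by (simp add: power2_norm_eq_inner flip: power2_eq_square)
    moreover have "norm (u n) * (q * norm (u (Suc n))) \<le> norm (u (Suc n)) * norm (u (Suc n))"
      using mult_right_mono[OF conjunct2[OF Suc] norm_ge_zero[of "u (Suc n)"]]
      by (simp add: mult_ac)
    ultimately have "norm (u n) * (q * norm (u (Suc n))) \<le> norm (u n) * norm (u (Suc (Suc n)))"
      by linarith
    then show ?case using Suc pos by (simp add: mult_le_cancel_left_pos)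
  qed
  have lower: "q ^ n * norm y \<le> norm (u n)" for n
  proof (induction n)
    case (Suc n)
    have "q * (q ^ n * norm y) \<le> q * norm (u n)"
      using Suc \<open>0 < q\<close> by (simp add: mult_left_mono)
    then show ?case using grow[of n] by (simp add: mult.assoc)
  qed (simp add: u0)
  have "(q / c) ^ n \<le> C / norm y" for n
  proof -
    have "q ^ n * norm y \<le> C * c ^ n" using lower[of n] bound[of n] by (simp add: u_def)
    then show ?thesis
      using \<open>0 < c\<close> \<open>0 < norm y\<close> by (simp add: power_divide divide_simps mult_ac)
  qed
  moreover obtain n where "C / norm y < (q / c) ^ n"
    using real_arch_pow[of "q / c" "C / norm y"] q(2) \<open>0 < c\<close> by (metis less_divide_eq_1_pos)
  ultimately show False by (meson not_less)
qed

lemma abs_of_selfadjoint: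
  fixes T :: "'a::{real_inner,banach} \<Rightarrow>\<^sub>L 'a"
  assumes sa: "\<And>x y. inner (T x) y = inner x (T y)"
  obtains Q :: "'a \<Rightarrow>\<^sub>L 'a"
    where "\<And>x y. inner (Q x) y = inner x (Q y)" "\<And>x. 0 \<le> inner (Q x) x"
    "Q o\<^sub>L Q = T o\<^sub>L T" "Q o\<^sub>L T = T o\<^sub>L Q"
    "\<And>M. \<lbrakk>closed M; id_blinfun \<in> M; T \<in> M; \<And>U V. U \<in> M \<Longrightarrow> V \<in> M \<Longrightarrow> U + V \<in> M;
        \<And>k U. U \<in> M \<Longrightarrow> k *\<^sub>R U \<in> M; \<And>U V. U \<in> M \<Longrightarrow> V \<in> M \<Longrightarrow> U o\<^sub>L V \<in> M\<rbrakk> \<Longrightarrow> Q \<in> M"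
proof -
  interpret comp: bounded_bilinear "(o\<^sub>L) :: ('a \<Rightarrow>\<^sub>L 'a) \<Rightarrow> _" by (rule bounded_bilinear_blinfun_compose)
  define k where "k = norm T + 1"
  have "0 < k" by (simp add: k_def add_nonneg_pos)
  define T' where "T' = (1/k) *\<^sub>R T"
  have T: "T = k *\<^sub>R T'" using \<open>0 < k\<close> by (simp add: T'_def)
  have "norm T' \<le> 1" using \<open>0 < k\<close> by (simp add: T'_def k_def)
  moreover have "inner (T' x) y = inner x (T' y)" for x y
    by (simp add: T'_def blinfun.bilinear_simps sa)
  ultimately obtain Q :: "'a \<Rightarrow>\<^sub>L 'a"
    where Q: "\<And>x y. inner (Q x) y = inner x (Q y)" "\<And>x. 0 \<le> inner (Q x) x"
      "Q o\<^sub>L Q = T' o\<^sub>L T'" "Q o\<^sub>L T' = T' o\<^sub>L Q"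
      and QM: "\<And>M. \<lbrakk>closed M; id_blinfun \<in> M; T' \<in> M; \<And>U V. U \<in> M \<Longrightarrow> V \<in> M \<Longrightarrow> U + V \<in> M;
        \<And>k U. U \<in> M \<Longrightarrow> k *\<^sub>R U \<in> M; \<And>U V. U \<in> M \<Longrightarrow> V \<in> M \<Longrightarrow> U o\<^sub>L V \<in> M\<rbrakk> \<Longrightarrow> Q \<in> M"
    using abs_of_selfadjoint_contraction[of T'] by metis
  show ?thesis
  proof (rule that[of "k *\<^sub>R Q"])
    show "inner ((k *\<^sub>R Q) x) y = inner x ((k *\<^sub>R Q) y)" for x y
      by (simp add: blinfun.bilinear_simps Q(1))
    show "0 \<le> inner ((k *\<^sub>R Q) x) x" for x
      using \<open>0 < k\<close> Q(2) by (simp add: blinfun.bilinear_simps)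
    show "k *\<^sub>R Q o\<^sub>L k *\<^sub>R Q = T o\<^sub>L T"
      unfolding T by (simp add: comp.scaleR_left comp.scaleR_right Q(3))
    show "k *\<^sub>R Q o\<^sub>L T = T o\<^sub>L k *\<^sub>R Q"
      unfolding T by (simp add: comp.scaleR_left comp.scaleR_right Q(4))
  next
    fix M :: "('a \<Rightarrow>\<^sub>L 'a) set"
    assume M: "closed M" "id_blinfun \<in> M" "T \<in> M" "\<And>U V. U \<in> M \<Longrightarrow> V \<in> M \<Longrightarrow> U + V \<in> M"
      "\<And>k U. U \<in> M \<Longrightarrow> k *\<^sub>R U \<in> M" "\<And>U V. U \<in> M \<Longrightarrow> V \<in> M \<Longrightarrow> U o\<^sub>L V \<in> M"
    have "T' \<in> M" unfolding T'_def by (intro M)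
    then have "Q \<in> M" by (rule QM[OF M(1,2) _ M(4-6)])
    then show "k *\<^sub>R Q \<in> M" by (rule M)
  qed
qed

section \<open>Adjoints in \<open>B(H)\<close>\<close>

text \<open>The imaginary part of the complex inner product is recovered from the real part by
  replacing \<open>y\<close> with \<open>\<i>y\<close>.\<close>

lemma inner_to_cinner_adjoint:
  fixes S T :: "'h::chilbert_space \<Rightarrow>\<^sub>L 'h"
  assumes "T \<in> BH" and "\<And>x y. inner (S x) y = inner x (T y)"
  shows "cinner (S x) y = cinner x (T y)"
proof (rule complex_eqI)
  have Re: "Re (cinner (S x) y) = Re (cinner x (T y))" for x y
    using assms(2)[of x y] by (simp add: inner_eq_Re_cinner)
  then show "Re (cinner (S x) y) = Re (cinner x (T y))" .
  have "Re (\<i> * cinner (S x) y) = Re (\<i> * cinner x (T y))"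
    using Re[of x "\<i> *\<^sub>C y"] assms(1) by (simp add: BH_def flip: cinner_scaleC_right)
  then show "Im (cinner (S x) y) = Im (cinner x (T y))" by simp
qed

lemma inner_adjoint_exists:
  fixes T :: "'a::{real_inner,complete_space} \<Rightarrow>\<^sub>L 'a"
  obtains S :: "'a \<Rightarrow>\<^sub>L 'a" where "\<And>x y. inner (S x) y = inner x (T y)"
proof -
  have "\<exists>z. \<forall>y. inner x (T y) = inner z y" for x
    using riesz_representation[of "\<lambda>y. inner x (T y)"]
    by (metis blinfun.bounded_linear_right bounded_linear_compose bounded_linear_inner_right)
  then obtain S where S: "\<And>x y. inner x (T y) = inner (S x) y" by metis
  have eqI: "u = v" if "\<And>y. inner u y = inner v y" for u v :: 'a
    using that[of "u - v"] by (metis inner_diff_left inner_eq_zero_iff right_minus_eq)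
  have "bounded_linear S"
  proof (rule bounded_linear_intro[where K = "norm T"])
    show "S (x + y) = S x + S y" for x y by (rule eqI) (simp add: inner_simps flip: S)
    show "S (r *\<^sub>R x) = r *\<^sub>R S x" for r x by (rule eqI) (simp add: inner_simps flip: S)
    show "norm (S x) \<le> norm x * norm T" for x
    proof (cases "S x = 0")
      case False
      have "norm (S x) * norm (S x) = inner x (T (S x))"
        by (simp add: S power2_norm_eq_inner flip: power2_eq_square)
      also have "\<dots> \<le> norm x * norm (T (S x))" by (rule norm_cauchy_schwarz)
      also have "\<dots> \<le> norm x * (norm T * norm (S x))"
        by (intro mult_left_mono norm_blinfun) simp
      finally show ?thesis using False by (simp add: mult.assoc[symmetric])
    qed simp
  qed
  then show ?thesis using that[of "Blinfun S"] S by (simp add: bounded_linear_Blinfun_apply)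
qed

text \<open>Justifies the definite description in the definition of the adjoint; from here on
  adjoints are handled through the real inner product only.\<close>

lemma inner_adj_op_left:
  fixes T :: "'h::chilbert_space \<Rightarrow>\<^sub>L 'h"
  assumes "T \<in> BH"
  shows "inner (adj_op T x) y = inner x (T y)"
proof -
  obtain S :: "'h \<Rightarrow>\<^sub>L 'h" where S: "\<And>x y. inner (S x) y = inner x (T y)"
    using inner_adjoint_exists[of T] by blast
  have "adj_op T = S"
    unfolding adj_op_def
  proof (rule the_equality)
    show "\<forall>x y. cinner (S x) y = cinner x (T y)" using inner_to_cinner_adjoint[OF assms S] by blast
  next
    fix S' :: "'h \<Rightarrow>\<^sub>L 'h" assume "\<forall>x y. cinner (S' x) y = cinner x (T y)"
    then have "inner (S' x - S x) y = 0" for x y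
      by (simp add: inner_diff_left S) (simp add: inner_eq_Re_cinner)
    then have "S' x = S x" for x using inner_eq_zero_iff right_minus_eq by blast
    then show "S' = S" by (rule blinfun_eqI)
  qed
  then show ?thesis by (simp add: S)
qed

lemma inner_adj_op_right: "T \<in> BH \<Longrightarrow> inner y (adj_op T x) = inner (T y) x"
  by (metis inner_adj_op_left inner_commute)

lemma zero_in_BH: "0 \<in> BH"
proof -
  have "0 *\<^sub>R (0::'a) = c *\<^sub>C 0" for c
    using scaleC_scaleC[of c "complex_of_real 0" "0::'a"] scaleC_of_real[of 0 "0::'a"] by simp
  then show ?thesis by (simp add: BH_def)
qed

lemma adj_op_zero: "adj_op 0 = 0"
proof (rule blinfun_eqI)
  fix x :: 'a
  have "inner (adj_op 0 x) (adj_op 0 x) = 0" by (simp add: inner_adj_op_left[OF zero_in_BH])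
  then show "adj_op 0 x = (0 :: 'a \<Rightarrow>\<^sub>L 'a) x" by simp
qed

lemma norm_adj_op_compose:
  assumes "T \<in> BH" shows "norm (adj_op T o\<^sub>L T) = (norm T)\<^sup>2"
proof (rule antisym)
  have le: "(norm (T x))\<^sup>2 \<le> norm (adj_op T o\<^sub>L T) * (norm x)\<^sup>2" for x
  proof -
    have "(norm (T x))\<^sup>2 = inner ((adj_op T o\<^sub>L T) x) x"
      by (simp add: power2_norm_eq_inner inner_adj_op_left assms)
    also have "\<dots> \<le> norm ((adj_op T o\<^sub>L T) x) * norm x" by (rule norm_cauchy_schwarz)
    also have "\<dots> \<le> norm (adj_op T o\<^sub>L T) * norm x * norm x"
      by (intro mult_right_mono norm_blinfun) simp
    finally show ?thesis by (simp add: power2_eq_square mult.assoc)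
  qed
  have "norm T \<le> sqrt (norm (adj_op T o\<^sub>L T))"
  proof (rule norm_blinfun_bound)
    show "norm (T x) \<le> sqrt (norm (adj_op T o\<^sub>L T)) * norm x" for x
      using real_sqrt_le_mono[OF le[of x]] by (simp add: real_sqrt_mult)
  qed simp
  then show "(norm T)\<^sup>2 \<le> norm (adj_op T o\<^sub>L T)"
    using power_mono[of "norm T" _ 2] by fastforce
  have "norm (adj_op T) \<le> norm T"
  proof (rule norm_blinfun_bound)
    fix x
    have "norm (adj_op T x) * norm (adj_op T x) = inner x (T (adj_op T x))"
      by (simp add: inner_adj_op_left assms power2_norm_eq_inner flip: power2_eq_square)
    also have "\<dots> \<le> norm x * norm (T (adj_op T x))" by (rule norm_cauchy_schwarz)
    also have "\<dots> \<le> norm x * (norm T * norm (adj_op T x))"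
      by (intro mult_left_mono norm_blinfun) simp
    finally have "norm (adj_op T x) * norm (adj_op T x) \<le> norm T * norm x * norm (adj_op T x)"
      by (simp add: mult_ac)
    then show "norm (adj_op T x) \<le> norm T * norm x"
      by (cases "adj_op T x = 0") auto
  qed simp
  then have "norm (adj_op T) * norm T \<le> norm T * norm T" by (intro mult_right_mono) auto
  then show "norm (adj_op T o\<^sub>L T) \<le> (norm T)\<^sup>2"
    using norm_blinfun_compose[of "adj_op T" T] by (simp add: power2_eq_square)
qed

section \<open>Product systems over a subsemigroup of a group\<close>

lemma closed_csubspace_scaleR:
  assumes "closed_csubspace V" "T \<in> V" shows "k *\<^sub>R T \<in> V"
proof -
  have "scale_op (complex_of_real k) T = k *\<^sub>R T"
  proof -
    have "(\<lambda>x. k *\<^sub>R T x) = blinfun_apply (k *\<^sub>R T)" by (simp add: fun_eq_iff blinfun.scaleR_left)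
    then show ?thesis unfolding scale_op_def scaleC_of_real by (simp add: blinfun_apply_inverse)
  qed
  moreover have "scale_op (complex_of_real k) T \<in> V" using assms by (simp add: closed_csubspace_def)
  ultimately show ?thesis by simp
qed

locale group_product_system = group G for G :: "('g, 'm) monoid_scheme" (structure) +
  fixes P :: "'g set"
    and X :: "'g \<Rightarrow> ('h::chilbert_space \<Rightarrow>\<^sub>L 'h) set"
  assumes sub: "submonoid P G" and ps: "product_system G P X"
begin

sublocale comp: bounded_bilinear "(o\<^sub>L) :: ('h \<Rightarrow>\<^sub>L 'h) \<Rightarrow> ('h \<Rightarrow>\<^sub>L 'h) \<Rightarrow> 'h \<Rightarrow>\<^sub>L 'h"
  by (rule bounded_bilinear_blinfun_compose)

lemma P_carrier: "p \<in> P \<Longrightarrow> p \<in> carrier G"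
  and P_one: "\<one> \<in> P"
  and P_mult: "p \<in> P \<Longrightarrow> q \<in> P \<Longrightarrow> p \<otimes> q \<in> P"
  using submonoid.subset[OF sub] submonoid.one_closed[OF sub] submonoid.m_closed[OF sub] by auto

lemma X_csubspace: "p \<in> P \<Longrightarrow> closed_csubspace (X p)"
  using ps by (simp add: product_system_def)

lemma X_closed: "p \<in> P \<Longrightarrow> closed (X p)"
  and X_BH: "p \<in> P \<Longrightarrow> \<xi> \<in> X p \<Longrightarrow> \<xi> \<in> BH"
  and X_zero: "p \<in> P \<Longrightarrow> 0 \<in> X p"
  and X_add: "p \<in> P \<Longrightarrow> \<xi> \<in> X p \<Longrightarrow> \<eta> \<in> X p \<Longrightarrow> \<xi> + \<eta> \<in> X p"
  using X_csubspace[of p] by (auto simp: closed_csubspace_def)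

lemma X_scaleR: "p \<in> P \<Longrightarrow> \<xi> \<in> X p \<Longrightarrow> k *\<^sub>R \<xi> \<in> X p"
  by (rule closed_csubspace_scaleR[OF X_csubspace])

lemma X_mult: "p \<in> P \<Longrightarrow> q \<in> P \<Longrightarrow> \<xi> \<in> X p \<Longrightarrow> \<eta> \<in> X q \<Longrightarrow> \<xi> o\<^sub>L \<eta> \<in> X (p \<otimes> q)"
  using ps by (simp add: product_system_def)

lemma X_left_mult: "p \<in> P \<Longrightarrow> a \<in> X \<one> \<Longrightarrow> \<xi> \<in> X p \<Longrightarrow> a o\<^sub>L \<xi> \<in> X p"
  using X_mult[of \<one> p a \<xi>] by (simp add: P_one P_carrier)

lemma X_right_mult: "p \<in> P \<Longrightarrow> a \<in> X \<one> \<Longrightarrow> \<xi> \<in> X p \<Longrightarrow> \<xi> o\<^sub>L a \<in> X p"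
  using X_mult[of p \<one> \<xi> a] by (simp add: P_one P_carrier)

lemma X_inner_mem: "p \<in> P \<Longrightarrow> \<xi> \<in> X p \<Longrightarrow> \<eta> \<in> X p \<Longrightarrow> adj_op \<xi> o\<^sub>L \<eta> \<in> X \<one>"
proof -
  assume "p \<in> P" "\<xi> \<in> X p" "\<eta> \<in> X p"
  moreover have "adj_op \<xi> o\<^sub>L \<zeta> \<in> X q" if "p \<in> P" "q \<in> P" "\<xi> \<in> X p" "\<zeta> \<in> X (p \<otimes> q)" for q \<zeta>
    using ps that by (simp add: product_system_def)
  ultimately show ?thesis using P_one by (simp add: P_carrier)
qed

lemma A_adj: "a \<in> X \<one> \<Longrightarrow> adj_op a \<in> X \<one>"
  using ps by (simp add: product_system_def cstar_subalgebra_def)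

lemma inner_A_adj: "a \<in> X \<one> \<Longrightarrow> inner (a x) y = inner x (adj_op a y)"
  by (simp add: inner_adj_op_right[OF X_BH[OF P_one]])

section \<open>The coefficient algebra acts faithfully on \<open>X\<^sub>F\<close>\<close>

text \<open>The maximality argument. The hypothesis asks only that \<open>f\<close> kill the elementary products
  \<open>\<xi>i\<close>, whose span is dense in the \<open>r\<close>-th summand of \<open>X\<^sub>F\<close>.\<close>

lemma A_faithful_on_XF:
  assumes F: "finite F" and f: "f \<in> X \<one>"
    and kills: "\<And>r \<xi> i. r \<in> P \<Longrightarrow> \<xi> \<in> X r \<Longrightarrow> i \<in> ideal_rF G P X r F \<Longrightarrow> f o\<^sub>L \<xi> o\<^sub>L i = 0"
    and FG: "F \<subseteq> carrier G"
  shows "f = 0"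
proof (rule ccontr)
  assume "f \<noteq> 0"
  \<comment> \<open>\<open>N r\<close> measures how far \<open>r\<close> is up the filtration given by \<open>F\<close>; it strictly increases from \<open>r\<close>
    to any element of \<open>rP \<inter> gP\<close> when \<open>r \<notin> gP\<close>.\<close>
  define N where "N r = card {g \<in> F. r \<in> g <# P}" for r
  define R where "R r \<longleftrightarrow> r \<in> P \<and> (\<exists>\<xi>\<in>X r. f o\<^sub>L \<xi> \<noteq> 0)" for r
  have "f o\<^sub>L adj_op f \<noteq> 0"
  proof
    assume "f o\<^sub>L adj_op f = 0"
    then have "f (adj_op f v) = 0" for v by (metis blinfun.zero_left blinfun_apply_blinfun_compose)
    then have "adj_op f v = 0" for v
      using apply_adjoint_apply_zero[of f "adj_op f"] inner_A_adj[OF f] by blast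
    then have "f v = 0" for v
      using apply_adjoint_apply_zero[of "adj_op f" f] inner_adj_op_left[OF X_BH[OF P_one f]] by blast
    with \<open>f \<noteq> 0\<close> show False by (metis blinfun_eqI blinfun.zero_left)
  qed
  then have "R \<one>" using P_one A_adj[OF f] by (auto simp: R_def)
  moreover have "N r \<le> card F" for r unfolding N_def by (rule card_mono) (use F in auto)
  ultimately obtain r where "R r" and max: "\<And>s. R s \<Longrightarrow> N s \<le> N r"
    using ex_has_greatest_nat[of R \<one> N "Suc (card F)"] by (metis less_Suc_eq_le)
  then obtain \<xi> where r: "r \<in> P" and \<xi>: "\<xi> \<in> X r" "f o\<^sub>L \<xi> \<noteq> 0" by (auto simp: R_def)
  define \<theta> where "\<theta> = f o\<^sub>L \<xi>"
  have \<theta>: "\<theta> \<in> X r" "\<theta> \<noteq> 0" using X_left_mult[OF r f \<xi>(1)] \<xi>(2) by (auto simp: \<theta>_def)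
  define i where "i = adj_op \<theta> o\<^sub>L \<theta>"
  have iA: "i \<in> X \<one>" unfolding i_def by (rule X_inner_mem[OF r \<theta>(1) \<theta>(1)])
  have kill_s: "i \<in> ker_phi G X (inv r \<otimes> s)"
    if g: "g \<in> F" "r \<notin> KF G P {r, g}" and s: "s \<in> KF G P {r, g}" for g s
  proof -
    obtain t where t: "t \<in> P" "s = r \<otimes> t" and sg: "s \<in> g <# P"
      using s by (auto simp: KF_def l_coset_def)
    have "s \<in> P" using t r P_mult by simp
    have "r \<in> r <# P" using r P_one by (force simp: l_coset_def P_carrier)
    then have rg: "r \<notin> g <# P" using g(2) r by (auto simp: KF_def P_carrier)
    have "{h \<in> F. r \<in> h <# P} \<subset> {h \<in> F. s \<in> h <# P}"
    proof
      show "{h \<in> F. r \<in> h <# P} \<subseteq> {h \<in> F. s \<in> h <# P}"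
      proof clarify
        fix h assume "h \<in> F" "r \<in> h <# P"
        then obtain p where p: "p \<in> P" "r = h \<otimes> p" by (auto simp: l_coset_def)
        then have "s = h \<otimes> (p \<otimes> t)" using t FG \<open>h \<in> F\<close> by (auto simp: P_carrier m_assoc)
        then show "s \<in> h <# P" using P_mult[OF p(1) t(1)] by (auto simp: l_coset_def)
      qed
      show "{h \<in> F. r \<in> h <# P} \<noteq> {h \<in> F. s \<in> h <# P}" using g(1) sg rg by blast
    qed
    then have "N r < N s" unfolding N_def using F by (intro psubset_card_mono) auto
    then have "\<not> R s" using max[of s] by linarith
    then have fs: "f o\<^sub>L \<zeta> = 0" if "\<zeta> \<in> X s" for \<zeta> using that \<open>s \<in> P\<close> by (auto simp: R_def)
    have "i o\<^sub>L \<zeta> = 0" if "\<zeta> \<in> X t" for \<zeta>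
    proof -
      have "\<xi> o\<^sub>L \<zeta> \<in> X s" unfolding t(2) by (rule X_mult[OF r t(1) \<xi>(1) that])
      then have "f o\<^sub>L (\<xi> o\<^sub>L \<zeta>) = 0" by (rule fs)
      then show ?thesis by (simp add: i_def \<theta>_def blinfun_compose_assoc)
    qed
    moreover have "inv r \<otimes> s = t"
      using t r by (simp add: P_carrier m_assoc[symmetric])
    ultimately show ?thesis using iA by (simp add: ker_phi_def)
  qed
  have "i \<in> ideal_rF G P X r F"
    unfolding ideal_rF_def ideal_rg_def using iA kill_s by auto
  then have "\<theta> o\<^sub>L i = 0" using kills[OF r \<xi>(1)] by (simp add: \<theta>_def)
  then have z: "\<theta> (adj_op \<theta> (\<theta> v)) = 0" for v
    by (metis i_def blinfun.zero_left blinfun_apply_blinfun_compose)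
  have BH: "\<theta> \<in> BH" by (rule X_BH[OF r \<theta>(1)])
  have "adj_op \<theta> (\<theta> v) = 0" for v
    by (rule apply_adjoint_apply_zero[of \<theta>]) (simp_all add: z inner_adj_op_right[OF BH])
  then have "\<theta> v = 0" for v
    by (intro apply_adjoint_apply_zero[of "adj_op \<theta>" \<theta>]) (simp_all add: inner_adj_op_left[OF BH])
  then show False using \<theta>(2) by (metis blinfun_eqI blinfun.zero_left)
qed

section \<open>Norm estimates from faithfulness\<close>

text \<open>The quantitative form of faithfulness: if \<open>b = a\<^sup>*a\<close> acts with norm at most \<open>c\<close> on the
  elementary products in \<open>X\<^sub>F\<close>, then \<open>\<langle>bw, w\<rangle> = \<parallel>aw\<parallel>\<^sup>2 \<le> c \<parallel>w\<parallel>\<^sup>2\<close> for \<open>w\<close> in the range of \<open>b\<close>.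
  Writing \<open>T = b - c\<close>, one shows that \<open>\<bar>T\<bar> + T\<close>, twice the positive part of \<open>T\<close>, vanishes on
  \<open>X\<^sub>F\<close>; faithfulness gives \<open>(\<bar>T\<bar> + T) b = 0\<close>, so \<open>T = - \<bar>T\<bar> \<le> 0\<close> on the range of \<open>b\<close>. The factor \<open>b\<close>
  brings the operator into \<open>A\<close>, which need not contain the identity.\<close>

lemma positive_cutoff_bound:
  assumes F: "finite F" "F \<subseteq> carrier G" and a: "a \<in> X \<one>" and "0 < c"
    and bound: "\<And>r \<xi> i. r \<in> P \<Longrightarrow> \<xi> \<in> X r \<Longrightarrow> i \<in> ideal_rF G P X r F \<Longrightarrow>
      norm (adj_op a o\<^sub>L a o\<^sub>L \<xi> o\<^sub>L i) \<le> c * norm (\<xi> o\<^sub>L i)"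
  shows "(norm (a (adj_op a (a v))))\<^sup>2 \<le> c * (norm (adj_op a (a v)))\<^sup>2"
proof -
  define b where "b = adj_op a o\<^sub>L a"
  have b: "b \<in> X \<one>" unfolding b_def by (rule X_inner_mem[OF P_one a a])
  have baa: "inner (b x) y = inner (a x) (a y)" for x y
    by (simp add: b_def inner_adj_op_left[OF X_BH[OF P_one a]])
  have bsa: "inner (b x) y = inner x (b y)" for x y
    by (metis baa inner_commute)
  define T where "T = b - c *\<^sub>R id_blinfun"
  have Tx: "T x = b x - c *\<^sub>R x" for x by (simp add: T_def blinfun.bilinear_simps)
  have Tsa: "inner (T x) y = inner x (T y)" for x y
    by (simp add: Tx inner_simps bsa)
  obtain Q :: "'h \<Rightarrow>\<^sub>L 'h" where Qsa: "\<And>x y. inner (Q x) y = inner x (Q y)"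
    and Qpos: "\<And>x. 0 \<le> inner (Q x) x" and QQ: "Q o\<^sub>L Q = T o\<^sub>L T" and QT: "Q o\<^sub>L T = T o\<^sub>L Q"
    and QM: "\<And>M. \<lbrakk>closed M; id_blinfun \<in> M; T \<in> M; \<And>U V. U \<in> M \<Longrightarrow> V \<in> M \<Longrightarrow> U + V \<in> M;
        \<And>k U. U \<in> M \<Longrightarrow> k *\<^sub>R U \<in> M; \<And>U V. U \<in> M \<Longrightarrow> V \<in> M \<Longrightarrow> U o\<^sub>L V \<in> M\<rbrakk> \<Longrightarrow> Q \<in> M"
    using abs_of_selfadjoint[of T, OF Tsa] by blast
  \<comment> \<open>Left multipliers of all \<open>X\<^sub>r\<close>: a unital closed algebra containing \<open>b\<close>, hence also \<open>\<bar>T\<bar>\<close>.\<close>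
  define M :: "('h \<Rightarrow>\<^sub>L 'h) set" where "M = {Z. \<forall>r\<in>P. \<forall>\<xi>\<in>X r. Z o\<^sub>L \<xi> \<in> X r}"
  have M_closed: "closed M"
  proof -
    have "M = (\<Inter>r\<in>P. \<Inter>\<xi>\<in>X r. (\<lambda>Z. Z o\<^sub>L \<xi>) -` X r)" by (auto simp: M_def)
    moreover have "closed ((\<lambda>Z. Z o\<^sub>L \<xi>) -` X r)" if "r \<in> P" for r and \<xi> :: "'h \<Rightarrow>\<^sub>L 'h"
      by (intro continuous_closed_vimage X_closed that) (rule linear_continuous_at[OF comp.bounded_linear_left])
    ultimately show ?thesis by auto
  qed
  have M_id: "id_blinfun \<in> M" by (simp add: M_def blinfun_compose_id)
  have M_b: "b \<in> M" using X_left_mult[OF _ b] by (simp add: M_def)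
  have M_add: "U + V \<in> M" if "U \<in> M" "V \<in> M" for U V
    using that X_add by (simp add: M_def comp.add_left)
  have M_scale: "k *\<^sub>R U \<in> M" if "U \<in> M" for k U
    using that X_scaleR by (simp add: M_def comp.scaleR_left)
  have M_mult: "U o\<^sub>L V \<in> M" if "U \<in> M" "V \<in> M" for U V
    using that by (simp add: M_def blinfun_compose_assoc)
  have M_T: "T \<in> M"
    using M_add[OF M_b M_scale[OF M_id, of "-c"]] by (simp add: T_def)
  have "Q \<in> M" by (rule QM[OF M_closed M_id M_T M_add M_scale M_mult])
  define N where "N = Q + T"
  have M_N: "N \<in> M" unfolding N_def by (rule M_add[OF \<open>Q \<in> M\<close> M_T])
  have Nx: "N x = Q x + T x" for x by (simp add: N_def blinfun.bilinear_simps)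
  have N_zero: "N (\<xi> (i h)) = 0" if r: "r \<in> P" and \<xi>: "\<xi> \<in> X r" and i: "i \<in> ideal_rF G P X r F" for r \<xi> i h
  proof -
    define v where "v = \<xi> (i h)"
    define y where "y = N v"
    \<comment> \<open>The elementary products are invariant under \<open>N\<close> and \<open>b\<close>, so the norm bound can be iterated.\<close>
    have powers: "\<exists>\<zeta>\<in>X r. (blinfun_apply b ^^ n) y = blinfun_apply \<zeta> (i h) \<and> norm (\<zeta> o\<^sub>L i) \<le> norm (N o\<^sub>L \<xi> o\<^sub>L i) * c ^ n" for n
    proof (induction n)
      case 0
      have "N o\<^sub>L \<xi> \<in> X r" using M_N r \<xi> by (simp add: M_def)
      then show ?case by (intro bexI[of _ "N o\<^sub>L \<xi>"]) (simp_all add: y_def v_def)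
    next
      case (Suc n)
      then obtain \<zeta> where \<zeta>: "\<zeta> \<in> X r" "(blinfun_apply b ^^ n) y = blinfun_apply \<zeta> (i h)"
        "norm (\<zeta> o\<^sub>L i) \<le> norm (N o\<^sub>L \<xi> o\<^sub>L i) * c ^ n" by blast
      have "norm (b o\<^sub>L \<zeta> o\<^sub>L i) \<le> c * norm (\<zeta> o\<^sub>L i)"
        unfolding b_def by (rule bound[OF r \<zeta>(1) i])
      also have "\<dots> \<le> c * (norm (N o\<^sub>L \<xi> o\<^sub>L i) * c ^ n)"
        using \<zeta>(3) \<open>0 < c\<close> by simp
      finally show ?case using \<zeta>(2)
        by (intro bexI[of _ "b o\<^sub>L \<zeta>"]) (simp_all add: mult_ac X_left_mult[OF r b \<zeta>(1)])
    qed
    have "norm ((blinfun_apply b ^^ n) y) \<le> (norm (N o\<^sub>L \<xi> o\<^sub>L i) * norm h) * c ^ n" for n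
    proof -
      obtain \<zeta> where \<zeta>: "(blinfun_apply b ^^ n) y = blinfun_apply \<zeta> (i h)"
        "norm (\<zeta> o\<^sub>L i) \<le> norm (N o\<^sub>L \<xi> o\<^sub>L i) * c ^ n"
        using powers[of n] by blast
      have "norm (\<zeta> (i h)) \<le> norm (\<zeta> o\<^sub>L i) * norm h"
        using norm_blinfun[of "\<zeta> o\<^sub>L i" h] by simp
      also have "\<dots> \<le> (norm (N o\<^sub>L \<xi> o\<^sub>L i) * c ^ n) * norm h"
        using \<zeta>(2) by (intro mult_right_mono) auto
      finally show ?thesis by (simp add: \<zeta>(1) mult_ac)
    qed
    then have "inner (b y) y \<le> c * (norm y)\<^sup>2"
      by (rule norm_pow_selfadjoint_bound_imp_form_bound[OF bsa \<open>0 < c\<close>])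
    \<comment> \<open>From \<open>(\<bar>T\<bar> - T)(\<bar>T\<bar> + T) = 0\<close> it follows that \<open>\<bar>T\<bar>y = Ty\<close>, which is both \<open>\<ge> 0\<close> and \<open>\<le> 0\<close> at \<open>y\<close>.\<close>
    then have "inner (T y) y \<le> 0" by (simp add: Tx inner_simps power2_norm_eq_inner)
    moreover have QyTy: "Q y = T y"
    proof -
      have "Q (Q v) = T (T v)" "Q (T v) = T (Q v)"
        using QQ QT by (metis blinfun_apply_blinfun_compose)+
      then show ?thesis by (simp add: y_def Nx blinfun.bilinear_simps)
    qed
    ultimately have "inner (Q y) y = 0" using Qpos[of y] by simp
    then have "Q y = 0" by (rule positive_form_zero_imp_apply_zero[OF Qsa Qpos])
    then have "inner v (N y) = 0" using QyTy by (simp add: Nx)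
    then have "inner (N v) y = 0" by (simp add: Nx inner_simps Qsa Tsa)
    then show ?thesis by (simp add: y_def v_def)
  qed
  have "N o\<^sub>L b = 0"
  proof (rule A_faithful_on_XF[OF F(1) _ _ F(2)])
    show "N o\<^sub>L b \<in> X \<one>" using M_N b P_one by (simp add: M_def)
    fix r \<xi> i assume "r \<in> P" "\<xi> \<in> X r" "i \<in> ideal_rF G P X r F"
    then have "N ((b o\<^sub>L \<xi>) (i h)) = 0" for h
      by (intro N_zero X_left_mult[OF _ b])
    then show "N o\<^sub>L b o\<^sub>L \<xi> o\<^sub>L i = 0"
      by (intro blinfun_eqI) simp
  qed
  define w where "w = b v"
  have "N w = 0" using \<open>N o\<^sub>L b = 0\<close> by (metis w_def blinfun.zero_left blinfun_apply_blinfun_compose)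
  then have "inner (Q w) w + inner (T w) w = 0" by (metis Nx inner_add_left inner_zero_left)
  then have "inner (T w) w \<le> 0" using Qpos[of w] by linarith
  then have "inner (b w) w \<le> c * inner w w" by (simp add: Tx inner_simps)
  then have "inner (a w) (a w) \<le> c * inner w w" by (simp only: baa)
  then show ?thesis by (simp add: w_def b_def power2_norm_eq_inner)
qed

section \<open>The norm of \<open>\<lambda>(a)\<close> on the modules \<open>X\<^sub>F\<close>\<close>

lemma fock_rep_one:
  assumes "\<eta> \<in> fock P X"
  shows "fock_rep G P X \<one> a \<eta> = (\<lambda>s. a o\<^sub>L \<eta> s)"
proof
  fix s
  have "l_coset G \<one> P = P" by (rule lcos_mult_one) (use P_carrier in blast)
  moreover have "\<eta> s = 0" if "s \<notin> P" using assms that by (simp add: fock_def dsum_def)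
  ultimately show "fock_rep G P X \<one> a \<eta> s = a o\<^sub>L \<eta> s"
    using assms by (auto simp: fock_rep_def P_carrier)
qed

text \<open>Makes the supremum in the operator norm one of a bounded set. Applied to vectors \<open>v\<close> and \<open>w\<close>,
  the operators \<open>\<langle>\<eta>,\<eta>\<rangle>\<close> and \<open>\<langle>a\<eta>,a\<eta>\<rangle>\<close> are sums of real numbers, which can be compared term by term. The
  norm of the second operator is read off from its sesquilinear form, with \<open>w\<close> of the same length as \<open>v\<close>.\<close>

lemma mod_norm_left_mult_le:
  assumes a: "a \<in> X \<one>" and \<eta>: "\<eta> \<in> fock P X"
  shows "mod_norm P (\<lambda>s. a o\<^sub>L \<eta> s) \<le> norm a * mod_norm P \<eta>"
proof -
  define B where "B = mod_inner P \<eta> \<eta>"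
  define B' where "B' = mod_inner P (\<lambda>s. a o\<^sub>L \<eta> s) (\<lambda>s. a o\<^sub>L \<eta> s)"
  have X: "\<eta> r \<in> X r" if "r \<in> P" for r using \<eta> that by (simp add: fock_def dsum_def)
  have BH: "\<eta> r \<in> BH" "a o\<^sub>L \<eta> r \<in> BH" if "r \<in> P" for r
    using X_BH[OF that] X[OF that] X_left_mult[OF that a] by auto
  have bl: "bounded_linear (\<lambda>T :: 'h \<Rightarrow>\<^sub>L 'h. inner (T v) w)" for v w
    by (intro bounded_linear_compose[OF bounded_linear_inner_left] blinfun.bounded_linear_left)
  have B: "((\<lambda>r. (norm (\<eta> r v))\<^sup>2) has_sum inner (B v) v) P" for v
  proof -
    have "((\<lambda>r. adj_op (\<eta> r) o\<^sub>L \<eta> r) has_sum B) P"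
      using \<eta> by (simp add: fock_def dsum_def B_def mod_inner_def)
    from has_sum_bounded_linear[OF bl this, of v v] show ?thesis
      by (rule has_sum_cong[THEN iffD1, rotated])
        (simp add: inner_adj_op_left BH power2_norm_eq_inner)
  qed
  have form: "inner (B v) v \<le> norm B * (norm v)\<^sup>2" for v
    using norm_cauchy_schwarz[of "B v" v] mult_right_mono[OF norm_blinfun[of B v] norm_ge_zero[of v]]
    by (simp add: power2_eq_square mult.assoc)
  have "norm B' \<le> (norm a)\<^sup>2 * norm B"
  proof (cases "(\<lambda>r. adj_op (a o\<^sub>L \<eta> r) o\<^sub>L (a o\<^sub>L \<eta> r)) summable_on P")
    \<comment> \<open>An infinite sum that does not converge has the value \<open>0\<close>.\<close>
    case False
    then have "B' = 0" by (simp add: B'_def mod_inner_def infsum_not_exists)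
    then show ?thesis by simp
  next
    case True
    then have B': "((\<lambda>r. adj_op (a o\<^sub>L \<eta> r) o\<^sub>L (a o\<^sub>L \<eta> r)) has_sum B') P"
      by (simp add: B'_def mod_inner_def)
    have polar: "inner (B' v) w \<le> (norm a)\<^sup>2 * norm B * (((norm v)\<^sup>2 + (norm w)\<^sup>2) / 2)" for v w
    proof -
      have "((\<lambda>r. inner (a (\<eta> r v)) (a (\<eta> r w))) has_sum inner (B' v) w) P"
        using has_sum_bounded_linear[OF bl B', of v w]
        by (rule has_sum_cong[THEN iffD1, rotated]) (simp add: inner_adj_op_left BH)
      moreover have "((\<lambda>r. (norm a)\<^sup>2 / 2 * ((norm (\<eta> r v))\<^sup>2 + (norm (\<eta> r w))\<^sup>2))
          has_sum (norm a)\<^sup>2 / 2 * (inner (B v) v + inner (B w) w)) P"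
        by (intro has_sum_cmult_right has_sum_add B)
      moreover have "inner (a x) (a y) \<le> (norm a)\<^sup>2 / 2 * ((norm x)\<^sup>2 + (norm y)\<^sup>2)" for x y
      proof -
        have "inner (a x) (a y) \<le> norm (a x) * norm (a y)" by (rule norm_cauchy_schwarz)
        also have "\<dots> \<le> (norm a * norm x) * (norm a * norm y)"
          by (intro mult_mono norm_blinfun) auto
        also have "\<dots> = (norm a)\<^sup>2 * (norm x * norm y)" by (simp add: power2_eq_square)
        also have "\<dots> \<le> (norm a)\<^sup>2 * (((norm x)\<^sup>2 + (norm y)\<^sup>2) / 2)"
          using sum_squares_bound[of "norm x" "norm y"] by (intro mult_left_mono) auto
        finally show ?thesis by simp
      qed
      ultimately have "inner (B' v) w \<le> (norm a)\<^sup>2 / 2 * (inner (B v) v + inner (B w) w)"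
        by (rule has_sum_mono)
      also have "\<dots> \<le> (norm a)\<^sup>2 / 2 * (norm B * (norm v)\<^sup>2 + norm B * (norm w)\<^sup>2)"
        using form[of v] form[of w] by (intro mult_left_mono add_mono) auto
      finally show ?thesis by (simp add: algebra_simps)
    qed
    show ?thesis
    proof (rule norm_blinfun_bound)
      fix v
      show "norm (B' v) \<le> (norm a)\<^sup>2 * norm B * norm v"
      proof (cases "B' v = 0 \<or> v = 0")
        case False
        define k where "k = norm v / norm (B' v)"
        have k: "0 < k" "k * norm (B' v) = norm v" using False by (simp_all add: k_def)
        have "norm v * norm (B' v) = inner (B' v) (k *\<^sub>R B' v)"
          by (simp add: k_def power2_eq_square flip: power2_norm_eq_inner)
        also have "\<dots> \<le> (norm a)\<^sup>2 * norm B * (((norm v)\<^sup>2 + (norm (k *\<^sub>R B' v))\<^sup>2) / 2)"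
          by (rule polar)
        also have "norm (k *\<^sub>R B' v) = norm v" using k by simp
        finally have "norm v * norm (B' v) \<le> norm v * ((norm a)\<^sup>2 * norm B * norm v)"
          by (simp add: power2_eq_square mult_ac)
        then show ?thesis using False by simp
      qed auto
    qed simp
  qed
  then show ?thesis
    unfolding mod_norm_def B_def[symmetric] B'_def[symmetric]
    using real_sqrt_le_mono by (fastforce simp: real_sqrt_mult)
qed

lemma op_prod_ideal:
  assumes r: "r \<in> P"
  shows op_prod_ideal_subset: "op_prod (X r) (ideal_rF G P X r F) \<subseteq> X r"
    and zero_in_op_prod_ideal: "0 \<in> op_prod (X r) (ideal_rF G P X r F)"
proof -
  show "op_prod (X r) (ideal_rF G P X r F) \<subseteq> X r"
    unfolding op_prod_def
    by (rule hull_minimal) (auto simp: X_csubspace[OF r] ideal_rF_def intro: X_right_mult[OF r])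
  show "0 \<in> op_prod (X r) (ideal_rF G P X r F)"
    unfolding op_prod_def hull_def by (auto simp: closed_csubspace_def)
qed

lemma XF_subset_fock: "XF G P X F \<subseteq> fock P X"
  using op_prod_ideal_subset by (fastforce simp: XF_def fock_def dsum_def)

lemma zero_in_XF: "(\<lambda>r. 0) \<in> XF G P X F"
  using zero_in_op_prod_ideal by (simp add: XF_def dsum_def)

lemma mod_inner_single:
  assumes "r \<in> P"
  shows "mod_inner P (\<lambda>s. if s = r then T else 0) (\<lambda>s. if s = r then T else 0) = adj_op T o\<^sub>L T"
proof -
  have "mod_inner P (\<lambda>s. if s = r then T else 0) (\<lambda>s. if s = r then T else 0)
      = infsum (\<lambda>s. adj_op T o\<^sub>L T) {r}"
    unfolding mod_inner_def by (rule infsum_cong_neutral) (use assms in auto)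
  then show ?thesis by simp
qed

lemma mod_norm_single:
  assumes "r \<in> P" "T \<in> BH"
  shows "mod_norm P (\<lambda>s. if s = r then T else 0) = norm T"
  by (simp add: mod_norm_def mod_inner_single norm_adj_op_compose assms)

lemma single_in_XF:
  assumes r: "r \<in> P" and "\<xi> \<in> X r" "i \<in> ideal_rF G P X r F"
  shows "(\<lambda>s. if s = r then \<xi> o\<^sub>L i else 0) \<in> XF G P X F" (is "?\<eta> \<in> _")
proof -
  have "\<xi> o\<^sub>L i \<in> op_prod (X r) (ideal_rF G P X r F)"
    unfolding op_prod_def by (rule subsetD[OF hull_subset]) (use assms in blast)
  then have "?\<eta> s \<in> op_prod (X s) (ideal_rF G P X s F)" if "s \<in> P" for s
    using zero_in_op_prod_ideal[OF that] by (cases "s = r") simp_all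
  moreover have "?\<eta> s = 0" if "s \<notin> P" for s using that r by (cases "s = r") simp_all
  moreover have "(\<lambda>s. adj_op (?\<eta> s) o\<^sub>L ?\<eta> s) summable_on P"
  proof (rule finite_nonzero_values_imp_summable_on)
    have "{s \<in> P. adj_op (?\<eta> s) o\<^sub>L ?\<eta> s \<noteq> 0} \<subseteq> {r}" by auto
    then show "finite {s \<in> P. adj_op (?\<eta> s) o\<^sub>L ?\<eta> s \<noteq> 0}" by (rule finite_subset) simp
  qed
  ultimately show ?thesis unfolding XF_def dsum_def by blast
qed

text \<open>Elementary products embed isometrically into \<open>X\<^sub>F\<close> as families supported at one point. The
  normalization is applied to the factor \<open>\<xi>\<close>, so that the result is again an elementary product.\<close>

lemma norm_left_mult_le_opnorm:
  assumes a: "a \<in> X \<one>" and r: "r \<in> P" and \<xi>: "\<xi> \<in> X r" and i: "i \<in> ideal_rF G P X r F"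
  shows "norm (a o\<^sub>L \<xi> o\<^sub>L i)
    \<le> mod_opnorm P (XF G P X F) (restrict (fock_rep G P X \<one> a) (XF G P X F)) * norm (\<xi> o\<^sub>L i)"
    (is "_ \<le> ?p * _")
proof (cases "\<xi> o\<^sub>L i = 0")
  case True
  then show ?thesis by (simp add: blinfun_compose_assoc)
next
  case False
  let ?L = "restrict (fock_rep G P X \<one> a) (XF G P X F)"
  have L: "?L \<eta> = (\<lambda>s. a o\<^sub>L \<eta> s)" if "\<eta> \<in> XF G P X F" for \<eta>
    using that fock_rep_one XF_subset_fock by auto
  have iA: "i \<in> X \<one>" using i by (simp add: ideal_rF_def)
  have bdd: "bdd_above ((\<lambda>\<eta>. mod_norm P (?L \<eta>)) ` {\<eta> \<in> XF G P X F. mod_norm P \<eta> \<le> 1})"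
  proof (rule bdd_aboveI2)
    fix \<eta> assume "\<eta> \<in> {\<eta> \<in> XF G P X F. mod_norm P \<eta> \<le> 1}"
    then have \<eta>: "\<eta> \<in> XF G P X F" "mod_norm P \<eta> \<le> 1" by auto
    have "mod_norm P (?L \<eta>) \<le> norm a * mod_norm P \<eta>"
      unfolding L[OF \<eta>(1)] using \<eta>(1) XF_subset_fock by (intro mod_norm_left_mult_le a) auto
    then show "mod_norm P (?L \<eta>) \<le> norm a"
      using mult_left_mono[OF \<eta>(2) norm_ge_zero[of a]] by simp
  qed
  define k where "k = 1 / norm (\<xi> o\<^sub>L i)"
  have "0 < k" using False by (simp add: k_def)
  define \<zeta> where "\<zeta> = k *\<^sub>R \<xi>"
  have \<zeta>: "\<zeta> \<in> X r" unfolding \<zeta>_def by (rule X_scaleR[OF r \<xi>])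
  define \<eta> where "\<eta> = (\<lambda>s. if s = r then \<zeta> o\<^sub>L i else 0)"
  have \<eta>: "\<eta> \<in> XF G P X F" unfolding \<eta>_def by (rule single_in_XF[OF r \<zeta> i])
  have mem: "\<zeta> o\<^sub>L i \<in> X r" by (rule X_right_mult[OF r iA \<zeta>])
  have "mod_norm P \<eta> = norm (\<zeta> o\<^sub>L i)"
    unfolding \<eta>_def by (rule mod_norm_single[OF r X_BH[OF r mem]])
  also have "\<dots> = 1" using False by (simp add: \<zeta>_def k_def comp.scaleR_left)
  finally have "mod_norm P (?L \<eta>) \<le> ?p"
    unfolding mod_opnorm_def using \<eta> by (intro cSUP_upper bdd) simp
  moreover have "?L \<eta> = (\<lambda>s. if s = r then a o\<^sub>L (\<zeta> o\<^sub>L i) else 0)"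
    unfolding L[OF \<eta>] by (auto simp: \<eta>_def)
  moreover have "a o\<^sub>L (\<zeta> o\<^sub>L i) \<in> BH" by (rule X_BH[OF r X_left_mult[OF r a mem]])
  ultimately have "norm (a o\<^sub>L (\<zeta> o\<^sub>L i)) \<le> ?p" by (simp add: mod_norm_single[OF r])
  moreover have "a o\<^sub>L (\<zeta> o\<^sub>L i) = k *\<^sub>R (a o\<^sub>L \<xi> o\<^sub>L i)"
    by (simp add: \<zeta>_def comp.scaleR_left comp.scaleR_right blinfun_compose_assoc)
  ultimately have "k * norm (a o\<^sub>L \<xi> o\<^sub>L i) \<le> ?p" using \<open>0 < k\<close> by simp
  then have "norm (a o\<^sub>L \<xi> o\<^sub>L i) / norm (\<xi> o\<^sub>L i) \<le> ?p"
    by (simp only: k_def times_divide_eq_left mult_1_left)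
  then show ?thesis
    by (rule pos_divide_le_eq[THEN iffD1, rotated]) (use False in simp)
qed

text \<open>For each \<open>c > 0\<close> some \<open>X\<^sub>F\<close> carries \<open>\<lambda>(a)\<close> with norm below \<open>c / (\<parallel>a\<^sup>*\<parallel> + 1)\<close>, hence \<open>a\<^sup>*a\<close> with norm at most
  \<open>c\<close>. Letting \<open>c\<close> tend to \<open>0\<close> in the cut-off estimate leaves \<open>aa\<^sup>*a = 0\<close>, so \<open>a = 0\<close>.\<close>

lemma restrictions_in_c0_imp_zero:
  assumes a: "a \<in> X \<one>" and c0: "restrictions G P X (fock_rep G P X \<one> a) \<in> c0_XF G P X"
  shows "a = 0"
proof -
  let ?p = "\<lambda>F. mod_opnorm P (XF G P X F) (restrict (fock_rep G P X \<one> a) (XF G P X F))"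
  have lim: "((\<lambda>F. mod_opnorm P (XF G P X F) (restrictions G P X (fock_rep G P X \<one> a) F)) \<longlongrightarrow> 0)
      (finite_subsets_at_top (carrier G))"
    using c0 by (simp add: c0_XF_def)
  have bound: "(norm (a (adj_op a (a v))))\<^sup>2 \<le> c * (norm (adj_op a (a v)))\<^sup>2" if "0 < c" for c v
  proof -
    define \<epsilon> where "\<epsilon> = c / (norm (adj_op a) + 1)"
    have pos: "0 < norm (adj_op a) + 1" by (simp add: add_nonneg_pos)
    have "0 < \<epsilon>" unfolding \<epsilon>_def by (rule divide_pos_pos[OF \<open>0 < c\<close> pos])
    have \<epsilon>c: "norm (adj_op a) * \<epsilon> \<le> c"
    proof -
      have "c = (norm (adj_op a) + 1) * \<epsilon>" using pos by (simp add: \<epsilon>_def)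
      then show ?thesis using \<open>0 < \<epsilon>\<close> by (simp add: algebra_simps)
    qed
    have "\<forall>\<^sub>F F in finite_subsets_at_top (carrier G).
        mod_opnorm P (XF G P X F) (restrictions G P X (fock_rep G P X \<one> a) F) < \<epsilon>"
      by (rule order_tendstoD(2)[OF lim \<open>0 < \<epsilon>\<close>])
    then obtain F where F: "finite F" "F \<subseteq> carrier G"
      and "mod_opnorm P (XF G P X F) (restrictions G P X (fock_rep G P X \<one> a) F) < \<epsilon>"
      unfolding eventually_finite_subsets_at_top by blast
    then have p: "?p F \<le> \<epsilon>" by (simp add: restrictions_def)
    show ?thesis
    proof (rule positive_cutoff_bound[OF F a \<open>0 < c\<close>])
      fix r \<xi> i assume ri: "r \<in> P" "\<xi> \<in> X r" "i \<in> ideal_rF G P X r F"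
      have "norm (adj_op a o\<^sub>L a o\<^sub>L \<xi> o\<^sub>L i) \<le> norm (adj_op a) * norm (a o\<^sub>L \<xi> o\<^sub>L i)"
        using norm_blinfun_compose[of "adj_op a" "a o\<^sub>L \<xi> o\<^sub>L i"] by (simp add: blinfun_compose_assoc)
      also have "\<dots> \<le> norm (adj_op a) * (?p F * norm (\<xi> o\<^sub>L i))"
        by (rule mult_left_mono[OF norm_left_mult_le_opnorm[OF a ri] norm_ge_zero])
      also have "\<dots> \<le> norm (adj_op a) * (\<epsilon> * norm (\<xi> o\<^sub>L i))"
        using p by (intro mult_left_mono mult_right_mono) auto
      also have "\<dots> \<le> c * norm (\<xi> o\<^sub>L i)"
        using mult_right_mono[OF \<epsilon>c norm_ge_zero[of "\<xi> o\<^sub>L i"]] by (simp add: mult.assoc)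
      finally show "norm (adj_op a o\<^sub>L a o\<^sub>L \<xi> o\<^sub>L i) \<le> c * norm (\<xi> o\<^sub>L i)" .
    qed
  qed
  have "a (adj_op a (a v)) = 0" for v
  proof -
    have "((\<lambda>c. c * (norm (adj_op a (a v)))\<^sup>2) \<longlongrightarrow> 0 * (norm (adj_op a (a v)))\<^sup>2) (at_right 0)"
      by (intro tendsto_intros)
    then have "(norm (a (adj_op a (a v))))\<^sup>2 \<le> 0 * (norm (adj_op a (a v)))\<^sup>2"
      by (rule tendsto_lowerbound) (auto simp: eventually_at_filter intro!: always_eventually bound)
    then show ?thesis by simp
  qed
  then have "adj_op a (a v) = 0" for v
    using apply_adjoint_apply_zero[of a "adj_op a"] inner_A_adj[OF a] by blast
  then have "a v = 0" for v
    using apply_adjoint_apply_zero[of "adj_op a" a] inner_adj_op_left[OF X_BH[OF P_one a]] by blast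
  then show ?thesis by (metis blinfun_eqI blinfun.zero_left)
qed

lemma restrictions_zero: "restrictions G P X (fock_rep G P X \<one> 0) = zero_family G P X"
  unfolding restrictions_def zero_family_def
  using XF_subset_fock by (intro restrict_ext) (simp add: fock_rep_one subset_iff)

lemma zero_family_in_c0: "zero_family G P X \<in> c0_XF G P X"
proof -
  let ?Z = "\<lambda>F. \<lambda>\<eta>\<in>XF G P X F. (\<lambda>r :: 'g. 0 :: 'h \<Rightarrow>\<^sub>L 'h)"
  have inner0: "mod_inner P (\<lambda>r. 0) \<eta> = 0" "mod_inner P \<eta> (\<lambda>r. 0) = 0" for \<eta> :: "'g \<Rightarrow> 'h \<Rightarrow>\<^sub>L 'h"
    by (simp_all add: mod_inner_def adj_op_zero)
  have adjointable: "?Z F \<in> adjointable P (XF G P X F)" for F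
  proof -
    have Z: "?Z F \<in> XF G P X F \<rightarrow>\<^sub>E XF G P X F" using zero_in_XF by auto
    show ?thesis
      unfolding adjointable_def
    proof (intro CollectI conjI bexI[of _ "?Z F"] ballI Z)
      fix \<xi> \<eta> assume "\<xi> \<in> XF G P X F" "\<eta> \<in> XF G P X F"
      then show "mod_inner P (?Z F \<xi>) \<eta> = mod_inner P \<xi> (?Z F \<eta>)" by (simp only: restrict_apply' inner0)
    qed
  qed
  have opnorm: "mod_opnorm P (XF G P X F) (?Z F) = 0" for F
  proof -
    have n0: "mod_norm P (\<lambda>r. 0 :: 'h \<Rightarrow>\<^sub>L 'h) = 0" by (simp add: mod_norm_def inner0)
    let ?U = "{\<eta> \<in> XF G P X F. mod_norm P \<eta> \<le> 1}"
    have "(\<lambda>r. 0) \<in> ?U" using zero_in_XF n0 by simp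
    then have nonempty: "?U \<noteq> {}" by blast
    have "(\<lambda>\<eta>. mod_norm P (?Z F \<eta>)) ` ?U = (\<lambda>\<eta>. 0) ` ?U"
    proof (rule image_cong[OF refl])
      fix \<eta> assume "\<eta> \<in> ?U"
      then have "?Z F \<eta> = (\<lambda>r. 0)" by (intro restrict_apply') blast
      then show "mod_norm P (?Z F \<eta>) = 0" using n0 by (simp only:)
    qed
    then show ?thesis
      unfolding mod_opnorm_def by (simp only: image_constant_conv nonempty if_False cSup_singleton)
  qed
  have Z: "zero_family G P X F = ?Z F" if "F \<in> finite_subsets G" for F
    using that by (simp add: zero_family_def)
  have "((\<lambda>F. mod_opnorm P (XF G P X F) (zero_family G P X F)) \<longlongrightarrow> 0) (finite_subsets_at_top (carrier G))"
  proof (rule tendsto_eventually)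
    show "\<forall>\<^sub>F F in finite_subsets_at_top (carrier G). mod_opnorm P (XF G P X F) (zero_family G P X F) = 0"
      unfolding eventually_finite_subsets_at_top
      by (intro exI[of _ "{}"]) (auto simp: Z opnorm)
  qed
  moreover have "zero_family G P X \<in> (\<Pi>\<^sub>E F\<in>finite_subsets G. adjointable P (XF G P X F))"
    using adjointable by (auto simp: zero_family_def)
  moreover have "\<exists>C. \<forall>F\<in>finite_subsets G. mod_opnorm P (XF G P X F) (zero_family G P X F) \<le> C"
    by (intro exI[of _ 0] ballI) (simp only: Z opnorm order_refl)
  ultimately show ?thesis by (simp add: c0_XF_def)
qed

end

theorem proposition4p16:
  fixes G :: "('g, 'm) monoid_scheme"
    and P :: "'g set"
    and X :: "'g \<Rightarrow> ('h::chilbert_space \<Rightarrow>\<^sub>L 'h) set"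
  assumes "group G"
    and "submonoid P G"
    and "product_system G P X"
  shows "restrictions G P X ` lambda_A G P X \<inter> c0_XF G P X = {zero_family G P X}"
proof -
  interpret group_product_system G P X
    by (intro group_product_system.intro group_product_system_axioms.intro assms)
  show ?thesis
  proof (intro equalityI subsetI)
    fix T assume "T \<in> restrictions G P X ` lambda_A G P X \<inter> c0_XF G P X"
    then obtain a where a: "a \<in> X \<one>\<^bsub>G\<^esub>" "T = restrictions G P X (fock_rep G P X \<one>\<^bsub>G\<^esub> a)" "T \<in> c0_XF G P X"
      by (auto simp: lambda_A_def)
    then have "a = 0" using restrictions_in_c0_imp_zero by simp
    then show "T \<in> {zero_family G P X}" using a(2) restrictions_zero by simp
  next
    fix T assume "T \<in> {zero_family G P X}"
    moreover have "zero_family G P X \<in> restrictions G P X ` lambda_A G P X"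
      unfolding lambda_A_def restrictions_zero[symmetric] using X_zero[OF P_one] by blast
    ultimately show "T \<in> restrictions G P X ` lambda_A G P X \<inter> c0_XF G P X"
      using zero_family_in_c0 by simp
  qed
qed

end
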